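(* Let $E$ be a nuclear Fréchet space with the properties $\underline{DN}$ and $\Omega$ and let $\varepsilon=(\varepsilon_n)_{n\in\mathbb N}$ be the associated exponent sequence of $E$. Then $\Delta(E)=\Delta(\Lambda_\infty(\varepsilon))$ if and only if $\delta(E)=\delta(\Lambda_\infty(\varepsilon))$.
   Context: The topology of a nuclear Fréchet space $E$ is given by an increasing sequence of Hilbertian seminorms $(\|\cdot\|_k)_{k\in\mathbb N}$; put $U_k=\{x\in E:\|x\|_k\le 1\}$, so $U_1\supset U_2\supset\cdots$ is a base of neighborhoods of zero. Kolmogorov diameters: for absolutely convex $V,U\subseteq E$ with $V\subseteq CU$ for some $C>0$, $d_n(V,U)=\inf\{\delta(V,U,L): L\text{ a subspace of }E,\ \dim L\le n\}$, $n=0,1,\dots$, where $\delta(V,U,L)=\inf\{t>0: V\subseteq tU+L\}$. Diametral dimension: $\Delta(E)=\{(t_n)_{n\in\mathbb N}:\forall p\ \exists q>p\ \lim_{n\to\infty}t_n d_n(U_q,U_p)=0\}$. Approximate diametral dimension: $\delta(E)=\bigcup_{U}\bigcup_{B}\{(t_n)_{n\in\mathbb N}:\lim_{n\to\infty}t_n/d_n(B,U)=0\}$, with $U$ running over all neighborhoods of zero and $B$ over all bounded subsets of $E$; equivalently $\delta(E)=\{(t_n)_{n\in\mathbb N}:\exists p\ \forall q>p\ \lim_{n\to\infty}t_n/d_n(U_q,U_p)=0\}$. Equalities and inclusions of $\Delta$'s and $\delta$'s are as sets of sequences. $\underline{DN}$: there is $p\in\mathbb N$ such that for each $k>p$ there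 exist $n>k$, $0<\tau<1$, $C>0$ with $\|x\|_k\le C\|x\|_p^{1-\tau}\|x\|_n^{\tau}$ for all $x\in E$. $\Omega$: for each $p\in\mathbb N$ there is $q>p$ such that for every $k>q$ there exist $0<\theta<1$, $C>0$ with $\|y\|_q^*\le C(\|y\|_p^* )^{1-\theta}(\|y\|_k^* )^{\theta}$ for all $y\in E'$, where $\|y\|_k^*=\sup\{|y(x)|:\|x\|_k\le1\}\in\mathbb R\cup\{+\infty\}$. Power series spaces: for an exponent sequence $\alpha=(\alpha_n)$ (non-negative, increasing, $\alpha_n\to+\infty$), $\Lambda_1(\alpha)=\{(x_n):\sup_n|x_n|e^{-\alpha_n/k}<\infty\ \forall k\in\mathbb N\}$ and $\Lambda_\infty(\alpha)=\{(x_n):\sup_n|x_n|e^{k\alpha_n}<\infty\ \forall k\in\mathbb N\}$, Fréchet spaces with these seminorms. All power series spaces are assumed nuclear; in particular $\Lambda_1(\varepsilon)$ is assumed nuclear for the associated exponent sequence $\varepsilon$. Known: $\Delta(\Lambda_1(\alpha))=\Lambda_1(\alpha)$; $\Delta(\Lambda_\infty(\alpha))=\Lambda_\infty(\alpha)'=\{(x_n):\exists R>0\ \sup_n|x_n|e^{-R\alpha_n}<\infty\}$; $\delta(\Lambda_1(\alpha))=\Lambda_1(\alpha)'=\{(x_n):\exists k\ \sup_n|x_n|e^{\alpha_n/k}<\infty\}$; $\delta(\Lambda_\infty(\alpha))=\Lambda_\infty(\alpha)$. Associated exponent sequence: for a nuclear Fréchet space $E$ with $\underline{DN}$ and $\Omega$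 it is the exponent sequence $\varepsilon$ (known to exist, unique up to equivalence) with $\Delta(\Lambda_1(\varepsilon))\subseteq\Delta(E)\subseteq\Delta(\Lambda_\infty(\varepsilon))$ such that, moreover, $\Lambda_1(\alpha)\subseteq\Delta(E)$ implies $\Lambda_1(\alpha)\subseteq\Lambda_1(\varepsilon)$, and $\Delta(E)\subseteq\Lambda_\infty(\alpha)'$ implies $\Lambda_\infty(\varepsilon)'\subseteq\Lambda_\infty(\alpha)'$. It is also known that $\delta(\Lambda_\infty(\varepsilon))\subseteq\delta(E)\subseteq\delta(\Lambda_1(\varepsilon))$. *)

theory Defs
  imports "HOL-Analysis.Analysis" "HOL-Library.Function_Algebras"
begin

text \<open>
  A space is given by a carrier inside an ambient vector space, the scalar multiplication of that
  ambient space, and a sequence of seminorms. The scalar field is an arbitrary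
  \<^class>\<open>real_normed_field\<close>; as the norm is multiplicative, this means the reals or the complex
  numbers. The seminorm with index \<open>k\<close> (from 0) is the \<open>(k+1)\<close>-st one when counting starts at 1.
\<close>

record ('k, 'a) graded_space =
  carr :: "'a set"
  smult :: "'k \<Rightarrow> 'a \<Rightarrow> 'a"
  snorm :: "nat \<Rightarrow> 'a \<Rightarrow> real"

definition unit_ball :: "('k, 'a) graded_space \<Rightarrow> nat \<Rightarrow> 'a set" where
  "unit_ball E k = {x \<in> carr E. snorm E k x \<le> 1}"


subsection \<open>The topology given by the seminorms\<close>

definition seminorm_open :: "('k, 'a::ab_group_add) graded_space \<Rightarrow> 'a set \<Rightarrow> bool" where
  "seminorm_open E S \<longleftrightarrow> S \<subseteq> carr E \<and>
     (\<forall>x\<in>S. \<exists>K r. finite K \<and> 0 < r \<and> {y \<in> carr E. \<forall>k\<in>K. snorm E k (y - x) < r} \<subseteq> S)"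

definition seminorm_topology :: "('k, 'a::ab_group_add) graded_space \<Rightarrow> 'a topology" where
  "seminorm_topology E = topology (seminorm_open E)"

lemma istopology_seminorm_open: "istopology (seminorm_open E)"
  unfolding istopology_def
proof (intro conjI allI impI)
  fix S T assume S: "seminorm_open E S" and T: "seminorm_open E T"
  show "seminorm_open E (S \<inter> T)"
    unfolding seminorm_open_def
  proof (intro conjI ballI)
    show "S \<inter> T \<subseteq> carr E"
      using S by (auto simp: seminorm_open_def)
    fix x assume x: "x \<in> S \<inter> T"
    obtain K r where K: "finite K" "0 < r" "{y \<in> carr E. \<forall>k\<in>K. snorm E k (y - x) < r} \<subseteq> S"
      using S x unfolding seminorm_open_def by blast
    obtain K' r' where K': "finite K'" "0 < r'"
        "{y \<in> carr E. \<forall>k\<in>K'. snorm E k (y - x) < r'} \<subseteq> T"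
      using T x unfolding seminorm_open_def by blast
    have "{y \<in> carr E. \<forall>k\<in>K \<union> K'. snorm E k (y - x) < min r r'} \<subseteq> S \<inter> T"
      using K(3) K'(3) by auto
    then show "\<exists>K r. finite K \<and> 0 < r \<and> {y \<in> carr E. \<forall>k\<in>K. snorm E k (y - x) < r} \<subseteq> S \<inter> T"
      using K(1,2) K'(1,2) by (intro exI[of _ "K \<union> K'"] exI[of _ "min r r'"]) auto
  qed
next
  fix \<K> assume "\<forall>S\<in>\<K>. seminorm_open E S"
  then show "seminorm_open E (\<Union>\<K>)"
    unfolding seminorm_open_def by (meson Sup_least Sup_upper UnionE order_trans)
qed

lemma openin_seminorm_topology: "openin (seminorm_topology E) = seminorm_open E"
  unfolding seminorm_topology_def by (simp add: istopology_seminorm_open topology_inverse')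

definition nbhd_of_zero :: "('k, 'a::ab_group_add) graded_space \<Rightarrow> 'a set \<Rightarrow> bool" where
  "nbhd_of_zero E U \<longleftrightarrow>
     U \<subseteq> carr E \<and> (\<exists>S. openin (seminorm_topology E) S \<and> 0 \<in> S \<and> S \<subseteq> U)"

definition bounded_subset ::
    "('k::real_normed_field, 'a::ab_group_add) graded_space \<Rightarrow> 'a set \<Rightarrow> bool" where
  "bounded_subset E B \<longleftrightarrow> B \<subseteq> carr E \<and>
     (\<forall>U. nbhd_of_zero E U \<longrightarrow> (\<exists>c>0. B \<subseteq> (\<lambda>u. smult E (of_real c) u) ` U))"

definition linear_form ::
    "('k::real_normed_field, 'a::ab_group_add) graded_space \<Rightarrow> ('a \<Rightarrow> 'k) \<Rightarrow> bool" where
  "linear_form E f \<longleftrightarrow>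
     (\<forall>x\<in>carr E. \<forall>y\<in>carr E. f (x + y) = f x + f y) \<and>
     (\<forall>c. \<forall>x\<in>carr E. f (smult E c x) = c * f x)"

definition dual_space ::
    "('k::real_normed_field, 'a::ab_group_add) graded_space \<Rightarrow> ('a \<Rightarrow> 'k) set" where
  "dual_space E = {f. linear_form E f \<and> continuous_map (seminorm_topology E) euclidean f}"

definition dual_norm ::
    "('k::real_normed_field, 'a) graded_space \<Rightarrow> nat \<Rightarrow> ('a \<Rightarrow> 'k) \<Rightarrow> ennreal" where
  "dual_norm E k f = (SUP x\<in>unit_ball E k. ennreal (norm (f x)))"


subsection \<open>Nuclear Frechet spaces\<close>

definition seminorm_on ::
    "('k::real_normed_field, 'a::ab_group_add) graded_space \<Rightarrow> ('a \<Rightarrow> real) \<Rightarrow> bool" where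
  "seminorm_on E q \<longleftrightarrow>
     (\<forall>x\<in>carr E. \<forall>y\<in>carr E. q (x + y) \<le> q x + q y) \<and>
     (\<forall>c. \<forall>x\<in>carr E. q (smult E c x) = norm c * q x)"

text \<open>Conjugation, written uniformly for both scalar fields.\<close>

definition scalar_conj :: "'k::real_normed_field \<Rightarrow> 'k" where
  "scalar_conj c = of_real ((norm c)\<^sup>2) / c"

lemma scalar_conj_real: "scalar_conj (c::real) = c"
  by (simp add: scalar_conj_def power2_eq_square)

lemma scalar_conj_complex: "scalar_conj (c::complex) = cnj c"
  by (simp add: scalar_conj_def complex_norm_square del: of_real_power)

definition hilbertian ::
    "('k::real_normed_field, 'a::ab_group_add) graded_space \<Rightarrow> ('a \<Rightarrow> real) \<Rightarrow> bool" where
  "hilbertian E q \<longleftrightarrow> (\<exists>h :: 'a \<Rightarrow> 'a \<Rightarrow> 'k.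
     (\<forall>x\<in>carr E. \<forall>y\<in>carr E. \<forall>z\<in>carr E. h (x + y) z = h x z + h y z) \<and>
     (\<forall>c. \<forall>x\<in>carr E. \<forall>y\<in>carr E. h (smult E c x) y = c * h x y) \<and>
     (\<forall>x\<in>carr E. \<forall>y\<in>carr E. h y x = scalar_conj (h x y)) \<and>
     (\<forall>x\<in>carr E. h x x = of_real ((q x)\<^sup>2)))"

definition seq_complete ::
    "('k, 'a::ab_group_add) graded_space \<Rightarrow> bool" where
  "seq_complete E \<longleftrightarrow> (\<forall>x. (\<forall>n::nat. x n \<in> carr E) \<longrightarrow>
     (\<forall>k. \<forall>e>0. \<exists>N. \<forall>m\<ge>N. \<forall>n\<ge>N. snorm E k (x m - x n) < e) \<longrightarrow>
     (\<exists>l\<in>carr E. \<forall>k. (\<lambda>n. snorm E k (x n - l)) \<longlonglongrightarrow> 0))"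

text \<open>
  Nuclearity in the sense of Grothendieck and Pietsch: for every \<open>p\<close> there is \<open>q\<close> such that the
  canonical map from the local normed space of \<open>q\<close> to that of \<open>p\<close> is nuclear, that is, equal to
  \<open>\<Sum>\<^sub>j f\<^sub>j \<otimes> y\<^sub>j\<close> with \<open>\<Sum>\<^sub>j \<parallel>f\<^sub>j\<parallel>\<^sub>q\<^sup>* \<parallel>y\<^sub>j\<parallel>\<^sub>p < \<infinity>\<close>. Forms on the quotient by the kernel of \<open>q\<close> that are
  bounded for \<open>q\<close> are the linear forms on \<open>E\<close> with finite dual norm.
\<close>

definition nuclear_canonical_map ::
    "('k::real_normed_field, 'a::ab_group_add) graded_space \<Rightarrow> nat \<Rightarrow> nat \<Rightarrow> bool" where
  "nuclear_canonical_map E q p \<longleftrightarrow> (\<exists>(f :: nat \<Rightarrow> 'a \<Rightarrow> 'k) (y :: nat \<Rightarrow> 'a).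
     (\<forall>j. linear_form E (f j) \<and> dual_norm E q (f j) < \<infinity> \<and> y j \<in> carr E) \<and>
     (\<Sum>j. dual_norm E q (f j) * ennreal (snorm E p (y j))) < \<infinity> \<and>
     (\<forall>x\<in>carr E. (\<lambda>N. snorm E p (x - (\<Sum>j<N. smult E (f j x) (y j)))) \<longlonglongrightarrow> 0))"

definition nuclear_space ::
    "('k::real_normed_field, 'a::ab_group_add) graded_space \<Rightarrow> bool" where
  "nuclear_space E \<longleftrightarrow> (\<forall>p. \<exists>q. nuclear_canonical_map E q p)"

definition nuclear_frechet_space ::
    "('k::real_normed_field, 'a::ab_group_add) graded_space \<Rightarrow> bool" where
  "nuclear_frechet_space E \<longleftrightarrow>
     vector_space (smult E) \<and> module.subspace (smult E) (carr E) \<and>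
     (\<forall>k. seminorm_on E (snorm E k) \<and> hilbertian E (snorm E k)) \<and>
     (\<forall>k. \<forall>x\<in>carr E. snorm E k x \<le> snorm E (Suc k) x) \<and>
     (\<forall>x\<in>carr E. (\<forall>k. snorm E k x = 0) \<longrightarrow> x = 0) \<and>
     seq_complete E \<and> nuclear_space E"


subsection \<open>Kolmogorov diameters and diametral dimensions\<close>

definition width ::
    "('k::real_normed_field, 'a::ab_group_add) graded_space \<Rightarrow> 'a set \<Rightarrow> 'a set \<Rightarrow> 'a set \<Rightarrow> real" where
  "width E V U L =
     Inf {t. 0 < t \<and> V \<subseteq> {smult E (of_real t) u + l | u l. u \<in> U \<and> l \<in> L}}"

text \<open>
  A subspace of dimension at most \<open>n\<close> is the span of at most \<open>n\<close> vectors; the library's \<open>dim\<close> is 0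
  for infinite-dimensional spaces.
\<close>

definition kolmogorov_diameter ::
    "('k::real_normed_field, 'a::ab_group_add) graded_space \<Rightarrow> nat \<Rightarrow> 'a set \<Rightarrow> 'a set \<Rightarrow> real" where
  "kolmogorov_diameter E n V U =
     Inf {width E V U (module.span (smult E) F) | F. F \<subseteq> carr E \<and> finite F \<and> card F \<le> n}"

definition diametral_dimension ::
    "('k::real_normed_field, 'a::ab_group_add) graded_space \<Rightarrow> (nat \<Rightarrow> 'k) set" where
  "diametral_dimension E = {t. \<forall>p. \<exists>q>p.
     (\<lambda>n. t n * of_real (kolmogorov_diameter E n (unit_ball E q) (unit_ball E p))) \<longlonglongrightarrow> 0}"

text \<open>
  The quotient is taken in \<^typ>\<open>ennreal\<close>, where \<open>c / 0 = \<infinity>\<close> for \<open>c > 0\<close> and \<open>0 / 0 = 0\<close>: where the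
  diameter vanishes, the sequence has to vanish eventually. In the reals \<open>c / 0 = 0\<close> would admit
  every sequence, for example with \<open>B = {0}\<close>.
\<close>

definition approx_diametral_dimension ::
    "('k::real_normed_field, 'a::ab_group_add) graded_space \<Rightarrow> (nat \<Rightarrow> 'k) set" where
  "approx_diametral_dimension E =
     (\<Union>U\<in>{U. nbhd_of_zero E U}. \<Union>B\<in>{B. bounded_subset E B}.
        {t. (\<lambda>n. ennreal (norm (t n)) / ennreal (kolmogorov_diameter E n B U)) \<longlonglongrightarrow> 0})"


subsection \<open>The linear topological invariants\<close>

definition has_DN :: "('k, 'a) graded_space \<Rightarrow> bool" where
  "has_DN E \<longleftrightarrow> (\<exists>p. \<forall>k>p. \<exists>n>k. \<exists>\<tau> C. 0 < \<tau> \<and> \<tau> < 1 \<and> 0 < C \<and>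
     (\<forall>x\<in>carr E. snorm E k x \<le> C * snorm E p x powr (1 - \<tau>) * snorm E n x powr \<tau>))"

definition ennreal_powr :: "ennreal \<Rightarrow> real \<Rightarrow> ennreal" where
  "ennreal_powr x a = (if x = \<infinity> then \<infinity> else ennreal (enn2real x powr a))"

text \<open>
  The product on the right-hand side is never \<open>0 \<cdot> \<infinity>\<close> except for \<open>y = 0\<close> on the carrier, since one
  vanishing dual norm forces \<open>y\<close> to vanish.
\<close>

definition has_Omega :: "('k::real_normed_field, 'a::ab_group_add) graded_space \<Rightarrow> bool" where
  "has_Omega E \<longleftrightarrow> (\<forall>p. \<exists>q>p. \<forall>k>q. \<exists>\<theta> C. 0 < \<theta> \<and> \<theta> < 1 \<and> 0 < C \<and>
     (\<forall>y\<in>dual_space E. dual_norm E q y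
        \<le> ennreal C * ennreal_powr (dual_norm E p y) (1 - \<theta>) * ennreal_powr (dual_norm E k y) \<theta>))"


subsection \<open>Power series spaces and the associated exponent sequence\<close>

definition exponent_sequence :: "(nat \<Rightarrow> real) \<Rightarrow> bool" where
  "exponent_sequence \<alpha> \<longleftrightarrow> (\<forall>n. 0 \<le> \<alpha> n) \<and> mono \<alpha> \<and> filterlim \<alpha> at_top sequentially"

definition weighted_sup_space ::
    "(nat \<Rightarrow> nat \<Rightarrow> real) \<Rightarrow> ('k::real_normed_field, nat \<Rightarrow> 'k) graded_space" where
  "weighted_sup_space a = \<lparr>
     carr = {x. \<forall>k. bdd_above (range (\<lambda>n. norm (x n) * a k n))},
     smult = (\<lambda>c x n. c * x n),
     snorm = (\<lambda>k x. SUP n. norm (x n) * a k n)\<rparr>"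

definition Lambda_1 :: "(nat \<Rightarrow> real) \<Rightarrow> ('k::real_normed_field, nat \<Rightarrow> 'k) graded_space" where
  "Lambda_1 \<alpha> = weighted_sup_space (\<lambda>k n. exp (- \<alpha> n / real (Suc k)))"

definition Lambda_inf :: "(nat \<Rightarrow> real) \<Rightarrow> ('k::real_normed_field, nat \<Rightarrow> 'k) graded_space" where
  "Lambda_inf \<alpha> = weighted_sup_space (\<lambda>k n. exp (real (Suc k) * \<alpha> n))"

definition Lambda_inf_dual :: "(nat \<Rightarrow> real) \<Rightarrow> (nat \<Rightarrow> 'k::real_normed_field) set" where
  "Lambda_inf_dual \<alpha> = {x. \<exists>R>0. bdd_above (range (\<lambda>n. norm (x n) * exp (- R * \<alpha> n)))}"

text \<open>
  In the two extremality conditions \<open>\<alpha>\<close> ranges over the exponent sequences for which the power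
  series space in question is nuclear.
\<close>

definition associated_exponent_sequence ::
    "('k::real_normed_field, 'a::ab_group_add) graded_space \<Rightarrow> (nat \<Rightarrow> real) \<Rightarrow> bool" where
  "associated_exponent_sequence E \<epsilon> \<longleftrightarrow>
     exponent_sequence \<epsilon> \<and>
     diametral_dimension (Lambda_1 \<epsilon>) \<subseteq> diametral_dimension E \<and>
     diametral_dimension E \<subseteq> diametral_dimension (Lambda_inf \<epsilon>) \<and>
     (\<forall>\<alpha>. exponent_sequence \<alpha> \<longrightarrow>
        nuclear_space (Lambda_1 \<alpha> :: ('k, nat \<Rightarrow> 'k) graded_space) \<longrightarrow>
        carr (Lambda_1 \<alpha>) \<subseteq> diametral_dimension E \<longrightarrow>
        (carr (Lambda_1 \<alpha>) :: (nat \<Rightarrow> 'k) set) \<subseteq> carr (Lambda_1 \<epsilon>)) \<and>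
     (\<forall>\<alpha>. exponent_sequence \<alpha> \<longrightarrow>
        nuclear_space (Lambda_inf \<alpha> :: ('k, nat \<Rightarrow> 'k) graded_space) \<longrightarrow>
        diametral_dimension E \<subseteq> Lambda_inf_dual \<alpha> \<longrightarrow>
        (Lambda_inf_dual \<epsilon> :: (nat \<Rightarrow> 'k) set) \<subseteq> Lambda_inf_dual \<alpha>)"

end

theory Submission
  imports Defs "Jordan_Normal_Form.Determinant" "HOL-Real_Asymp.Real_Asymp"
begin

text \<open>
  Everything is a comparison of the diameters \<open>d\<^sub>n(U\<^sub>q, U\<^sub>p)\<close> with powers of \<open>exp (- \<epsilon>\<^sub>n)\<close>. In the
  power series space of infinite type \<open>d\<^sub>n(U\<^sub>q, U\<^sub>p)\<close> equals \<open>exp (- (q - p) \<epsilon>\<^sub>n)\<close>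
  (\<open>Lambda_inf_diameter\<close>). So its diametral dimension consists of the sequences that grow at most
  like some \<open>exp (R \<epsilon>\<^sub>n)\<close>, and its approximate diametral dimension of those that decay faster than
  every \<open>exp (- R \<epsilon>\<^sub>n)\<close>. For every nuclear space, \<open>t\<close> lies in the approximate diametral
  dimension iff for some \<open>p\<close> it is negligible against all \<open>d\<^sub>n(U\<^sub>q, U\<^sub>p)\<close>, \<open>q \<ge> p\<close>
  (\<open>approx_diametral_dimensionD\<close> and \<open>approx_diametral_dimensionI\<close>). Write \<open>\<Delta>\<close> and \<open>\<delta>\<close> for the two
  dimensions and \<open>\<Lambda>\<close> for the power series space of infinite type.

  Two inclusions are dual to each other. If \<open>\<Delta>(E)\<close> contains all sequences \<open>exp (R \<epsilon>\<^sub>n)\<close>, then for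
  given \<open>p\<close> the diameters \<open>d\<^sub>n(U\<^sub>q, U\<^sub>p)\<close> fall below every \<open>exp (- R \<epsilon>\<^sub>n)\<close> as \<open>q\<close> grows, and
  \<open>\<delta>(E) \<subseteq> \<delta>(\<Lambda>)\<close>. If conversely some such sequence is missing from \<open>\<Delta>(E)\<close>, then there
  are \<open>p\<close> and \<open>R\<close> such that \<open>d\<^sub>n(U\<^sub>q, U\<^sub>p) \<ge> exp (- R \<epsilon>\<^sub>n)\<close> infinitely often for every \<open>q\<close>; a diagonal
  choice of indices gives a sequence supported on them that lies in \<open>\<delta>(E)\<close> but not in \<open>\<delta>(\<Lambda>)\<close>.

  The inclusion \<open>\<delta>(\<Lambda>) \<subseteq> \<delta>(E)\<close> needs the interpolation inequality of the seminorms. It yields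
  (\<open>DN_diameters\<close>) an index \<open>p\<close> such that each \<open>k > p\<close> admits \<open>m\<close>, \<open>C\<close> and \<open>s > 0\<close> with
  \<open>d\<^sub>n(U\<^sub>m, U\<^sub>k) \<le> C (2 n + 1)\<^bsup>1 + s\<^esup> d\<^sub>n(U\<^sub>k, U\<^sub>p)\<^bsup>s\<^esup>\<close>. If for some \<open>k\<close> the numbers \<open>d\<^sub>n(U\<^sub>k, U\<^sub>p)\<close> were below
  every \<open>exp (- S \<epsilon>\<^sub>n)\<close> infinitely often, then along one subsequence all diameters would be that
  small, so \<open>\<Delta>(E)\<close> would contain a sequence growing faster than every \<open>exp (R \<epsilon>\<^sub>n)\<close>, against
  \<open>\<Delta>(E) \<subseteq> \<Delta>(\<Lambda>)\<close>. Hence \<open>d\<^sub>n(U\<^sub>k, U\<^sub>p) \<ge> exp (- S \<epsilon>\<^sub>n)\<close> eventually, for some \<open>S\<close>, which puts all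
  of \<open>\<delta>(\<Lambda>)\<close> into \<open>\<delta>(E)\<close>. The polynomial factor is absorbed because nuclearity of the power
  series space of finite type forces \<open>n + 1 \<le> G exp (\<epsilon>\<^sub>n)\<close> (\<open>nuclear_Lambda_1_growth\<close>).

  The estimate of \<open>DN_diameters\<close> is immediate for Gelfand numbers, that is, for
  approximation on the common kernel of \<open>n\<close> linear forms, because the interpolation inequality
  restricts to subspaces. Passing from \<open>n\<close>-dimensional subspaces to kernels of \<open>n\<close> forms and back
  costs a factor of order \<open>n\<close> each time. Both passages use \<open>bounded_spanning_points\<close>, a form of
  Auerbach's lemma; the forms come from the expansion \<open>\<Sum>\<^sub>j f\<^sub>j \<otimes> y\<^sub>j\<close> of a nuclear canonical map.
\<close>


section \<open>Spanning points with bounded coefficients\<close>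

(* The short name smult is kept for the scalar multiplication of a graded space. *)
hide_const (open) Module.smult

definition evaluation_matrix :: "('x \<Rightarrow> 'k::field) list \<Rightarrow> 'x list \<Rightarrow> 'k Matrix.mat" where
  "evaluation_matrix gs xs =
     Matrix.mat (length gs) (length xs) (\<lambda>(a, b). (gs ! a) (xs ! b))"

lemma evaluation_matrix_carrier:
  "length xs = length gs \<Longrightarrow> evaluation_matrix gs xs \<in> carrier_mat (length gs) (length gs)"
  by (simp add: evaluation_matrix_def)

lemma evaluation_matrix_index:
  "a < length gs \<Longrightarrow> b < length xs \<Longrightarrow> evaluation_matrix gs xs $$ (a, b) = (gs ! a) (xs ! b)"
  by (simp add: evaluation_matrix_def)

lemma det_evaluation_matrix_nonzero_imp_distinct:
  fixes gs :: "('x \<Rightarrow> 'k::field) list"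
  assumes len: "length xs = length gs" and det: "Determinant.det (evaluation_matrix gs xs) \<noteq> 0"
  shows "distinct gs" "distinct xs"
proof -
  let ?A = "evaluation_matrix gs xs" and ?r = "length gs"
  have A: "?A \<in> carrier_mat ?r ?r"
    using len by (rule evaluation_matrix_carrier)
  show "distinct gs"
  proof (rule ccontr)
    assume "\<not> distinct gs"
    then obtain i j where ij: "i < ?r" "j < ?r" "i \<noteq> j" "gs ! i = gs ! j"
      by (auto simp: distinct_conv_nth)
    then have "Matrix.row ?A i = Matrix.row ?A j"
      by (intro eq_vecI) (auto simp: evaluation_matrix_def)
    then show False
      using det det_identical_rows[OF A ij(3,1,2)] by simp
  qed
  show "distinct xs"
  proof (rule ccontr)
    assume "\<not> distinct xs"
    then obtain i j where ij: "i < ?r" "j < ?r" "i \<noteq> j" "xs ! i = xs ! j"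
      using len by (auto simp: distinct_conv_nth)
    then have "Matrix.col ?A i = Matrix.col ?A j"
      using len by (intro eq_vecI) (auto simp: evaluation_matrix_def)
    then show False
      using det det_identical_columns[OF A ij(3,1,2)] by simp
  qed
qed

lemma norm_det_evaluation_matrix_le:
  fixes gs :: "('x \<Rightarrow> 'k::real_normed_field) list"
  assumes len: "length xs = length gs" and bd: "\<And>g x. g \<in> set gs \<Longrightarrow> x \<in> set xs \<Longrightarrow> norm (g x) \<le> M"
  shows "norm (Determinant.det (evaluation_matrix gs xs)) \<le> fact (length gs) * M ^ length gs"
proof -
  let ?r = "length gs" and ?A = "evaluation_matrix gs xs"
  have "norm (Determinant.det ?A) \<le>
      (\<Sum>p\<in>{p. p permutes {0..<?r}}. norm (signof p * (\<Prod>i = 0..<?r. ?A $$ (i, p i))))"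
    unfolding det_def'[OF evaluation_matrix_carrier[OF len]] by (rule norm_sum)
  also have "\<dots> \<le> (\<Sum>p\<in>{p. p permutes {0..<?r}}. M ^ ?r)"
  proof (rule sum_mono)
    fix p assume "p \<in> {p. p permutes {0..<?r}}"
    then have p: "p permutes {0..<?r}" by simp
    have "norm (signof p * (\<Prod>i = 0..<?r. ?A $$ (i, p i)) :: 'k) = (\<Prod>i = 0..<?r. norm (?A $$ (i, p i)))"
      by (auto simp: sign_def norm_mult prod_norm)
    also have "\<dots> \<le> (\<Prod>i = 0..<?r. M)"
    proof (rule prod_mono, intro conjI)
      fix i assume i: "i \<in> {0..<?r}"
      then have "p i < ?r" using permutes_in_image[OF p] by auto
      then show "norm (?A $$ (i, p i)) \<le> M"
        using i len by (auto simp: evaluation_matrix_index intro!: bd)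
    qed simp
    finally show "norm (signof p * (\<Prod>i = 0..<?r. ?A $$ (i, p i)) :: 'k) \<le> M ^ ?r" by simp
  qed
  also have "\<dots> = fact ?r * M ^ ?r"
    by (simp add: card_permutations)
  finally show ?thesis .
qed

text \<open>
  Laplace expansion along the new last column: the cofactors do not depend on the new point,
  and the last one is the given nonzero minor, so the vanishing of the bordered determinant is a
  linear relation that expresses the new function by the old ones.
\<close>

lemma linear_combination_of_maximal_minor:
  fixes gs :: "('x \<Rightarrow> 'k::field) list"
  assumes len: "length xs = length gs" and det: "Determinant.det (evaluation_matrix gs xs) \<noteq> 0"
    and zero: "\<And>x. x \<in> X \<Longrightarrow> Determinant.det (evaluation_matrix (gs @ [g]) (xs @ [x])) = 0"
  shows "\<exists>\<alpha>. \<forall>x\<in>X. g x = (\<Sum>a<length gs. \<alpha> a * (gs ! a) x)"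
proof -
  let ?r = "length gs" and ?A = "evaluation_matrix gs xs"
  let ?B = "\<lambda>x. evaluation_matrix (gs @ [g]) (xs @ [x])"
  define \<beta> where "\<beta> a = cofactor (?B undefined) a ?r" for a
  have cof: "cofactor (?B x) a ?r = \<beta> a" if "a < Suc ?r" for x a
  proof -
    have "mat_delete (?B x) a ?r = mat_delete (?B undefined) a ?r"
      using len that by (intro eq_matI) (auto simp: mat_delete_def evaluation_matrix_def nth_append)
    then show ?thesis by (simp add: \<beta>_def cofactor_def)
  qed
  have "mat_delete (?B undefined) ?r ?r = ?A"
    using len by (intro eq_matI) (auto simp: mat_delete_def evaluation_matrix_def nth_append)
  then have last: "\<beta> ?r = Determinant.det ?A"
    by (simp add: \<beta>_def cofactor_def)
  have "g x = (\<Sum>a<?r. (- \<beta> a / Determinant.det ?A) * (gs ! a) x)" if x: "x \<in> X" for x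
  proof -
    have B: "?B x \<in> carrier_mat (Suc ?r) (Suc ?r)"
      using evaluation_matrix_carrier[of "xs @ [x]" "gs @ [g]"] len by simp
    have "0 = (\<Sum>a<Suc ?r. ?B x $$ (a, ?r) * cofactor (?B x) a ?r)"
      using laplace_expansion_column[OF B, of ?r] zero[OF x] by simp
    also have "\<dots> = (\<Sum>a<Suc ?r. ((gs @ [g]) ! a) x * \<beta> a)"
      using len by (intro sum.cong refl) (simp add: cof evaluation_matrix_index nth_append)
    also have "\<dots> = (\<Sum>a<?r. (gs ! a) x * \<beta> a) + g x * Determinant.det ?A"
      using last by (simp add: nth_append)
    finally have "g x * Determinant.det ?A = - (\<Sum>a<?r. (gs ! a) x * \<beta> a)"
      by (simp add: eq_neg_iff_add_eq_0 add.commute)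
    moreover have "(\<Sum>a<?r. (- \<beta> a / Determinant.det ?A) * (gs ! a) x) * Determinant.det ?A =
        (\<Sum>a<?r. - ((gs ! a) x * \<beta> a))"
      unfolding sum_distrib_right using det by (intro sum.cong) auto
    ultimately have "g x * Determinant.det ?A =
        (\<Sum>a<?r. (- \<beta> a / Determinant.det ?A) * (gs ! a) x) * Determinant.det ?A"
      by (simp only: sum_negf)
    then show ?thesis by (rule mult_right_cancel[OF det, THEN iffD1])
  qed
  then show ?thesis
    by (intro exI[of _ "\<lambda>a. - \<beta> a / Determinant.det ?A"] ballI)
qed

lemma solve_by_cramer:
  fixes gs :: "('x \<Rightarrow> 'k::field) list"
  assumes len: "length xs = length gs" and det: "Determinant.det (evaluation_matrix gs xs) \<noteq> 0"
  shows "\<exists>c. (\<forall>a<length gs. (gs ! a) x = (\<Sum>b<length gs. c b * (gs ! a) (xs ! b))) \<and>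
    (\<forall>b<length gs. Determinant.det (evaluation_matrix gs (xs[b := x])) =
       c b * Determinant.det (evaluation_matrix gs xs))"
proof -
  let ?r = "length gs" and ?A = "evaluation_matrix gs xs"
  have A: "?A \<in> carrier_mat ?r ?r"
    using len by (rule evaluation_matrix_carrier)
  define v where "v = Matrix.vec ?r (\<lambda>a. (gs ! a) x)"
  define c where "c = (1 / Determinant.det ?A) \<cdot>\<^sub>v (adj_mat ?A *\<^sub>v v)"
  have v: "v \<in> carrier_vec ?r" by (simp add: v_def)
  have adj: "adj_mat ?A \<in> carrier_mat ?r ?r" "?A * adj_mat ?A = Determinant.det ?A \<cdot>\<^sub>m 1\<^sub>m ?r"
    using adj_mat[OF A] by auto
  have c: "c \<in> carrier_vec ?r" using adj v by (simp add: c_def)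
  have "?A *\<^sub>v c = (1 / Determinant.det ?A) \<cdot>\<^sub>v (?A *\<^sub>v (adj_mat ?A *\<^sub>v v))"
    unfolding c_def using A adj v by (intro mult_mat_vec) auto
  also have "?A *\<^sub>v (adj_mat ?A *\<^sub>v v) = (?A * adj_mat ?A) *\<^sub>v v"
    by (rule assoc_mult_mat_vec[OF A adj(1) v, symmetric])
  also have "\<dots> = Determinant.det ?A \<cdot>\<^sub>v v"
    unfolding adj using v by auto
  finally have Ac: "?A *\<^sub>v c = v"
    using det by (simp add: smult_smult_assoc)
  have "(gs ! a) x = (\<Sum>b<?r. vec_index c b * (gs ! a) (xs ! b))" if a: "a < ?r" for a
  proof -
    have "(gs ! a) x = vec_index (?A *\<^sub>v c) a"
      unfolding Ac using a by (simp add: v_def)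
    also have "\<dots> = (\<Sum>b<?r. vec_index c b * (gs ! a) (xs ! b))"
      using a A c len
      by (auto simp: scalar_prod_def evaluation_matrix_def lessThan_atLeast0 mult.commute intro!: sum.cong)
    finally show ?thesis .
  qed
  moreover have "Determinant.det (evaluation_matrix gs (xs[b := x])) = vec_index c b * Determinant.det ?A"
    if b: "b < ?r" for b
  proof -
    have "replace_col ?A v b = evaluation_matrix gs (xs[b := x])"
      using len by (intro eq_matI) (auto simp: replace_col_def evaluation_matrix_def v_def nth_list_update)
    then show ?thesis
      using cramer_lemma_mat[OF A c b] Ac by simp
  qed
  ultimately show ?thesis by blast
qed

text \<open>
  Auerbach's lemma for a finite set of bounded functions. Among the functions take
  a largest subfamily with a nonvanishing determinant of values; the other functions are linear
  combinations of it. Then choose the points so that this determinant exceeds half of its supremum.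
  By Cramer's rule each coefficient is a quotient of two such determinants, hence at most 2.
  The number of points is at most the number of functions, and the bound 2 does not depend on it; this
  is what keeps all later losses polynomial in the dimension.
\<close>

lemma bounded_spanning_points:
  fixes G :: "('x \<Rightarrow> 'k::real_normed_field) set"
  assumes "finite G" and bdd: "\<And>g. g \<in> G \<Longrightarrow> \<exists>M. \<forall>x\<in>X. norm (g x) \<le> M"
  shows "\<exists>Z\<subseteq>X. finite Z \<and> card Z \<le> card G \<and>
    (\<forall>x\<in>X. \<exists>c. (\<forall>z\<in>Z. norm (c z) \<le> 2) \<and> (\<forall>g\<in>G. g x = (\<Sum>z\<in>Z. c z * g z)))"
proof -
  define minor where "minor r \<longleftrightarrow> (\<exists>gs xs. length gs = r \<and> length xs = r \<and> set gs \<subseteq> G \<and> set xs \<subseteq> X \<and>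
    Determinant.det (evaluation_matrix gs xs) \<noteq> 0)" for r
  have le: "r \<le> card G" if "minor r" for r
  proof -
    obtain gs xs where gs: "length gs = r" "length xs = r" "set gs \<subseteq> G"
        "Determinant.det (evaluation_matrix gs xs) \<noteq> 0"
      using \<open>minor r\<close> unfolding minor_def by blast
    then have "distinct gs"
      using det_evaluation_matrix_nonzero_imp_distinct(1)[of xs gs] by simp
    then have "r = card (set gs)"
      using gs(1) by (simp add: distinct_card)
    then show ?thesis
      using card_mono[OF \<open>finite G\<close> gs(3)] by simp
  qed
  have "minor 0"
    unfolding minor_def by (intro exI[of _ "[]"]) (simp add: evaluation_matrix_def)
  obtain r where r: "minor r" and max: "\<And>r'. minor r' \<Longrightarrow> r' \<le> r"
    using GreatestI_nat[of minor, OF \<open>minor 0\<close>] Greatest_le_nat[of minor] le by blast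
  obtain gs xs where gs: "length gs = r" "length xs = r" "set gs \<subseteq> G" "set xs \<subseteq> X"
      "Determinant.det (evaluation_matrix gs xs) \<noteq> 0"
    using r unfolding minor_def by blast
  have dep: "\<exists>\<alpha>. \<forall>x\<in>X. g x = (\<Sum>a<r. \<alpha> a * (gs ! a) x)" if g: "g \<in> G" for g
  proof -
    have "Determinant.det (evaluation_matrix (gs @ [g]) (xs @ [x])) = 0" if x: "x \<in> X" for x
    proof (rule ccontr)
      assume "Determinant.det (evaluation_matrix (gs @ [g]) (xs @ [x])) \<noteq> 0"
      then have "minor (Suc r)"
        unfolding minor_def using gs g x
        by (intro exI[of _ "gs @ [g]"] exI[of _ "xs @ [x]"]) auto
      then show False using max by fastforce
    qed
    then show ?thesis
      using linear_combination_of_maximal_minor[of xs gs X g] gs by simp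
  qed
  define D where "D = {norm (Determinant.det (evaluation_matrix gs ys)) | ys. length ys = r \<and> set ys \<subseteq> X}"
  obtain M where M: "\<And>g x. g \<in> G \<Longrightarrow> x \<in> X \<Longrightarrow> norm (g x) \<le> M g"
    using bdd by metis
  have Dle: "d \<le> fact r * (Max (M ` set gs)) ^ r" if dD: "d \<in> D" for d
  proof -
    obtain ys where ys: "d = norm (Determinant.det (evaluation_matrix gs ys))" "length ys = r" "set ys \<subseteq> X"
      using dD unfolding D_def by blast
    have "norm (g y) \<le> Max (M ` set gs)" if "g \<in> set gs" "y \<in> set ys" for g y
      using M[of g y] that gs(3) ys(3) by (intro order_trans[OF M Max_ge]) auto
    then show ?thesis
      using norm_det_evaluation_matrix_le[of ys gs] ys gs(1) by simp
  qed
  then have bD: "bdd_above D" by (auto simp: bdd_above_def)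
  have inD: "norm (Determinant.det (evaluation_matrix gs xs)) \<in> D"
    unfolding D_def using gs by blast
  then have pos: "0 < Sup D"
    using cSup_upper[OF _ bD] gs(5) by (metis less_le_trans zero_less_norm_iff)
  then obtain d where d: "d \<in> D" "Sup D / 2 < d"
    using less_cSupD[of D "Sup D / 2"] inD by fastforce
  from d(1) obtain ys where ys: "d = norm (Determinant.det (evaluation_matrix gs ys))" "length ys = r" "set ys \<subseteq> X"
    by (auto simp: D_def)
  have det: "Determinant.det (evaluation_matrix gs ys) \<noteq> 0"
    using d pos ys(1) by auto
  have dist: "distinct ys"
    using det_evaluation_matrix_nonzero_imp_distinct(2)[of ys gs] det ys gs by simp
  have "\<exists>c. (\<forall>z\<in>set ys. norm (c z) \<le> 2) \<and> (\<forall>g\<in>G. g x = (\<Sum>z\<in>set ys. c z * g z))" if x: "x \<in> X" for x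
  proof -
    obtain c where c: "\<And>a. a < r \<Longrightarrow> (gs ! a) x = (\<Sum>b<r. c b * (gs ! a) (ys ! b))"
      and cr: "\<And>b. b < r \<Longrightarrow> Determinant.det (evaluation_matrix gs (ys[b := x])) =
        c b * Determinant.det (evaluation_matrix gs ys)"
      using solve_by_cramer[of ys gs x] det ys gs by auto
    have c2: "norm (c b) \<le> 2" if b: "b < r" for b
    proof -
      have "norm (c b) * d \<in> D"
        unfolding D_def
        using cr[OF b] ys b x set_update_subset_insert[of ys b x]
        by (intro CollectI exI[of _ "ys[b := x]"]) (auto simp: norm_mult)
      then have "norm (c b) * d \<le> 2 * d"
        using cSup_upper[OF _ bD] d(2) by fastforce
      then show ?thesis using d(2) pos by simp
    qed
    have bij: "bij_betw (\<lambda>b. ys ! b) {..<r} (set ys)"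
      using bij_betw_nth[OF dist] ys(2) by simp
    define idx where "idx = inv_into {..<r} (\<lambda>b. ys ! b)"
    have idx: "idx (ys ! b) = b" if "b < r" for b
      unfolding idx_def using bij that by (intro inv_into_f_f) (auto simp: bij_betw_def)
    have "g x = (\<Sum>z\<in>set ys. c (idx z) * g z)" if g: "g \<in> G" for g
    proof -
      obtain \<alpha> where \<alpha>: "\<And>x. x \<in> X \<Longrightarrow> g x = (\<Sum>a<r. \<alpha> a * (gs ! a) x)"
        using dep[OF g] by blast
      have "g x = (\<Sum>a<r. \<Sum>b<r. \<alpha> a * (c b * (gs ! a) (ys ! b)))"
        using \<alpha>[OF x] c by (simp add: sum_distrib_left)
      also have "\<dots> = (\<Sum>b<r. \<Sum>a<r. \<alpha> a * (c b * (gs ! a) (ys ! b)))"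
        by (rule sum.swap)
      also have "\<dots> = (\<Sum>b<r. c b * g (ys ! b))"
      proof (rule sum.cong)
        fix b assume "b \<in> {..<r}"
        then have "ys ! b \<in> X" using ys by auto
        then show "(\<Sum>a<r. \<alpha> a * (c b * (gs ! a) (ys ! b))) = c b * g (ys ! b)"
          by (simp add: \<alpha> sum_distrib_left mult.left_commute)
      qed simp
      also have "\<dots> = (\<Sum>z\<in>set ys. c (idx z) * g z)"
        using sum.reindex_bij_betw[OF bij, of "\<lambda>z. c (idx z) * g z"] idx by simp
      finally show ?thesis .
    qed
    moreover have "norm (c (idx z)) \<le> 2" if "z \<in> set ys" for z
      using that c2 idx ys(2) by (auto simp: in_set_conv_nth)
    ultimately show ?thesis by (intro exI[of _ "\<lambda>z. c (idx z)"]) auto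
  qed
  moreover have "card (set ys) \<le> card G"
    using le[OF r] dist ys(2) by (simp add: distinct_card)
  ultimately show ?thesis
    using ys(3) by (intro exI[of _ "set ys"]) auto
qed

section \<open>Seminormed scales and Kolmogorov diameters\<close>

text \<open>
  The numbers \<open>t\<close> over which the two nested infima in \<^const>\<open>kolmogorov_diameter\<close> run.
\<close>

definition approximable ::
    "('k::real_normed_field, 'a::ab_group_add) graded_space \<Rightarrow> nat \<Rightarrow> 'a set \<Rightarrow> 'a set \<Rightarrow> real \<Rightarrow> bool" where
  "approximable E n V U t \<longleftrightarrow> 0 < t \<and> (\<exists>F\<subseteq>carr E. finite F \<and> card F \<le> n \<and>
     V \<subseteq> {smult E (of_real t) u + l | u l. u \<in> U \<and> l \<in> module.span (smult E) F})"

text \<open>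
  Absorption makes the sets of numbers in the definition of the diameters nonempty; the infimum of
  the empty set of reals is unspecified.
\<close>

definition absorbed ::
    "('k::real_normed_field, 'a::ab_group_add) graded_space \<Rightarrow> 'a set \<Rightarrow> 'a set \<Rightarrow> bool" where
  "absorbed E V U \<longleftrightarrow> (\<exists>t>0. V \<subseteq> (\<lambda>u. smult E (of_real t) u) ` U)"

text \<open>
  The linear and monotone structure of a graded space, shared by a nuclear Frechet space
  and by the weighted sequence spaces.
\<close>

locale seminormed_scale = vector_space "smult E"
  for E :: "('k::real_normed_field, 'a::ab_group_add) graded_space" +
  assumes carr_subspace: "subspace (carr E)"
    and seminorm: "\<And>k. seminorm_on E (snorm E k)"
    and snorm_le_Suc: "\<And>k x. x \<in> carr E \<Longrightarrow> snorm E k x \<le> snorm E (Suc k) x"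
begin

abbreviation diam :: "nat \<Rightarrow> nat \<Rightarrow> nat \<Rightarrow> real" where
  "diam n q p \<equiv> kolmogorov_diameter E n (unit_ball E q) (unit_ball E p)"

lemma carr_closed [simp, intro]:
  "0 \<in> carr E"
  "x \<in> carr E \<Longrightarrow> y \<in> carr E \<Longrightarrow> x + y \<in> carr E"
  "x \<in> carr E \<Longrightarrow> y \<in> carr E \<Longrightarrow> x - y \<in> carr E"
  "x \<in> carr E \<Longrightarrow> smult E c x \<in> carr E"
  using carr_subspace subspace_0 subspace_add subspace_diff subspace_scale by blast+

lemma carr_sum: "(\<And>i. i \<in> A \<Longrightarrow> f i \<in> carr E) \<Longrightarrow> sum f A \<in> carr E"
  using carr_subspace subspace_sum by blast

lemma span_subset_carr: "F \<subseteq> carr E \<Longrightarrow> span F \<subseteq> carr E"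
  using carr_subspace span_minimal by blast

lemma unit_ball_subset_carr: "unit_ball E k \<subseteq> carr E"
  by (auto simp: unit_ball_def)

lemma snorm_triangle: "x \<in> carr E \<Longrightarrow> y \<in> carr E \<Longrightarrow> snorm E k (x + y) \<le> snorm E k x + snorm E k y"
  using seminorm by (auto simp: seminorm_on_def)

lemma snorm_scale: "x \<in> carr E \<Longrightarrow> snorm E k (smult E c x) = norm c * snorm E k x"
  using seminorm by (auto simp: seminorm_on_def)

lemma snorm_zero [simp]: "snorm E k 0 = 0"
  using snorm_scale[of 0 k 0] by simp

lemma snorm_uminus: "x \<in> carr E \<Longrightarrow> snorm E k (- x) = snorm E k x"
  using snorm_scale[of x k "-1"] by (simp add: scale_minus_left)

lemma snorm_diff: "x \<in> carr E \<Longrightarrow> y \<in> carr E \<Longrightarrow> snorm E k (x - y) \<le> snorm E k x + snorm E k y"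
  using snorm_triangle[of x "- y" k] snorm_uminus[of y k] carr_closed(3)[of 0 y] by simp

lemma snorm_nonneg [simp]: "x \<in> carr E \<Longrightarrow> 0 \<le> snorm E k x"
  using snorm_diff[of x x k] by simp

lemma snorm_mono: "x \<in> carr E \<Longrightarrow> p \<le> q \<Longrightarrow> snorm E p x \<le> snorm E q x"
  using lift_Suc_mono_le[of "\<lambda>k. snorm E k x" p q] snorm_le_Suc by blast

lemma snorm_sum:
  assumes "finite A" "\<And>i. i \<in> A \<Longrightarrow> f i \<in> carr E"
  shows "snorm E k (sum f A) \<le> (\<Sum>i\<in>A. snorm E k (f i))"
  using assms
proof (induction A rule: finite_induct)
  case (insert i A)
  have "snorm E k (f i + sum f A) \<le> snorm E k (f i) + snorm E k (sum f A)"
    using insert.prems by (intro snorm_triangle carr_sum) auto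
  also have "snorm E k (sum f A) \<le> (\<Sum>i\<in>A. snorm E k (f i))"
    using insert by auto
  finally show ?case using insert.hyps by simp
qed simp

lemma unit_ball_antimono: "p \<le> q \<Longrightarrow> unit_ball E q \<subseteq> unit_ball E p"
  using snorm_mono by (fastforce simp: unit_ball_def)

lemma scaled_mem_unit_ball:
  assumes "x \<in> carr E" "snorm E k x \<le> t" "0 < t"
  shows "smult E (of_real (1 / t)) x \<in> unit_ball E k"
  using assms by (simp add: unit_ball_def snorm_scale norm_divide divide_le_eq)

lemma scale_cancel_of_real: "t \<noteq> 0 \<Longrightarrow> smult E (of_real t) (smult E (of_real (1 / t)) x) = x"
  by (simp flip: of_real_mult)

lemma approximable_unit_ball_iff:
  assumes "V \<subseteq> carr E"
  shows "approximable E n V (unit_ball E p) t \<longleftrightarrow> 0 < t \<and>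
    (\<exists>F\<subseteq>carr E. finite F \<and> card F \<le> n \<and> (\<forall>x\<in>V. \<exists>l\<in>span F. snorm E p (x - l) \<le> t))"
proof -
  have "V \<subseteq> {smult E (of_real t) u + l | u l. u \<in> unit_ball E p \<and> l \<in> span F} \<longleftrightarrow>
      (\<forall>x\<in>V. \<exists>l\<in>span F. snorm E p (x - l) \<le> t)" (is "?L \<longleftrightarrow> ?R")
    if t: "0 < t" and F: "F \<subseteq> carr E" for F
  proof
    assume L: ?L
    show ?R
    proof
      fix x assume "x \<in> V"
      then obtain u l where u: "u \<in> unit_ball E p" "l \<in> span F" "x = smult E (of_real t) u + l"
        using L by blast
      have "snorm E p (x - l) \<le> t"
        using u t by (simp add: snorm_scale unit_ball_def mult_left_le)
      then show "\<exists>l\<in>span F. snorm E p (x - l) \<le> t" using u by blast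
    qed
  next
    assume R: ?R
    show ?L
    proof
      fix x assume x: "x \<in> V"
      then obtain l where l: "l \<in> span F" "snorm E p (x - l) \<le> t"
        using R by blast
      have "x - l \<in> carr E"
        using x l assms span_subset_carr[OF F] by blast
      then have "smult E (of_real (1 / t)) (x - l) \<in> unit_ball E p"
        using l t by (intro scaled_mem_unit_ball)
      moreover have "x = smult E (of_real t) (smult E (of_real (1 / t)) (x - l)) + l"
        using t by (subst scale_cancel_of_real) auto
      ultimately show "x \<in> {smult E (of_real t) u + l | u l. u \<in> unit_ball E p \<and> l \<in> span F}"
        using l by blast
    qed
  qed
  then show ?thesis
    unfolding approximable_def by blast
qed

lemma absorbed_unit_ball:
  assumes "V \<subseteq> carr E" "\<And>x. x \<in> V \<Longrightarrow> snorm E p x \<le> M"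
  shows "absorbed E V (unit_ball E p)"
  unfolding absorbed_def
proof (intro exI conjI)
  show "0 < max M 1" by simp
  show "V \<subseteq> (\<lambda>u. smult E (of_real (max M 1)) u) ` unit_ball E p"
  proof
    fix x assume x: "x \<in> V"
    have "smult E (of_real (1 / max M 1)) x \<in> unit_ball E p"
      using assms x by (intro scaled_mem_unit_ball) (auto simp: max.coboundedI1)
    then show "x \<in> (\<lambda>u. smult E (of_real (max M 1)) u) ` unit_ball E p"
      using scale_cancel_of_real[of "max M 1" x] by (intro image_eqI[where x = "smult E (of_real (1 / max M 1)) x"]) auto
  qed
qed

lemma absorbed_unit_balls: "p \<le> q \<Longrightarrow> absorbed E (unit_ball E q) (unit_ball E p)"
  using unit_ball_antimono[of p q] unit_ball_subset_carr
  by (intro absorbed_unit_ball[where M = 1]) (auto simp: unit_ball_def)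

lemma width_set_nonempty:
  assumes "absorbed E V U"
  shows "{t. 0 < t \<and> V \<subseteq> {smult E (of_real t) u + l | u l. u \<in> U \<and> l \<in> span F}} \<noteq> {}"
proof -
  obtain t where t: "0 < t" "V \<subseteq> (\<lambda>u. smult E (of_real t) u) ` U"
    using assms unfolding absorbed_def by blast
  have "V \<subseteq> {smult E (of_real t) u + l | u l. u \<in> U \<and> l \<in> span F}"
  proof
    fix x assume "x \<in> V"
    then obtain u where "u \<in> U" "x = smult E (of_real t) u"
      using t by blast
    then show "x \<in> {smult E (of_real t) u + l | u l. u \<in> U \<and> l \<in> span F}"
      using span_zero[of F] by (intro CollectI exI[of _ u] exI[of _ 0]) auto
  qed
  then show ?thesis using t by blast
qed

lemma width_nonneg: "absorbed E V U \<Longrightarrow> 0 \<le> width E V U (span F)"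
  unfolding width_def using width_set_nonempty[of V U F] by (intro cInf_greatest) auto

lemma kolmogorov_diameter_le:
  assumes "absorbed E V U" "approximable E n V U t"
  shows "kolmogorov_diameter E n V U \<le> t"
proof -
  obtain F where F: "0 < t" "F \<subseteq> carr E" "finite F" "card F \<le> n"
      "V \<subseteq> {smult E (of_real t) u + l | u l. u \<in> U \<and> l \<in> span F}"
    using assms(2) unfolding approximable_def by blast
  have "kolmogorov_diameter E n V U \<le> width E V U (span F)"
    unfolding kolmogorov_diameter_def using F width_nonneg[OF assms(1)]
    by (intro cInf_lower bdd_belowI[where m = 0]) auto
  also have "\<dots> \<le> t"
    unfolding width_def using F by (intro cInf_lower) (auto simp: bdd_below_def intro: less_imp_le)
  finally show ?thesis .
qed

lemma kolmogorov_diameter_greatest: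
  assumes "absorbed E V U" "\<And>t. approximable E n V U t \<Longrightarrow> c \<le> t"
  shows "c \<le> kolmogorov_diameter E n V U"
  unfolding kolmogorov_diameter_def
proof (rule cInf_greatest)
  show "{width E V U (span F) | F. F \<subseteq> carr E \<and> finite F \<and> card F \<le> n} \<noteq> {}"
    by (auto intro!: exI[of _ "{}"])
  fix w assume "w \<in> {width E V U (span F) | F. F \<subseteq> carr E \<and> finite F \<and> card F \<le> n}"
  then obtain F where F: "w = width E V U (span F)" "F \<subseteq> carr E" "finite F" "card F \<le> n"
    by blast
  show "c \<le> w"
    unfolding F(1) width_def using width_set_nonempty[OF assms(1)] assms(2) F
    by (intro cInf_greatest) (auto simp: approximable_def)
qed

lemma kolmogorov_diameter_nonneg: "absorbed E V U \<Longrightarrow> 0 \<le> kolmogorov_diameter E n V U"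
  by (rule kolmogorov_diameter_greatest) (auto simp: approximable_def)

lemma approximable_of_kolmogorov_diameter_less:
  assumes "absorbed E V U" "kolmogorov_diameter E n V U < r"
  shows "\<exists>t<r. approximable E n V U t"
  using kolmogorov_diameter_greatest[OF assms(1), of n r] assms(2) by (meson not_le)

lemma diam_antimono:
  assumes "p \<le> q" "q \<le> q'"
  shows "diam n q' p \<le> diam n q p"
proof (rule kolmogorov_diameter_greatest[OF absorbed_unit_balls[OF assms(1)]])
  fix t assume "approximable E n (unit_ball E q) (unit_ball E p) t"
  then have "approximable E n (unit_ball E q') (unit_ball E p) t"
    using unit_ball_antimono[OF assms(2)] unfolding approximable_def by blast
  then show "diam n q' p \<le> t"
    using assms by (intro kolmogorov_diameter_le absorbed_unit_balls) auto
qed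

lemma diam_mono:
  assumes "p \<le> p'" "p' \<le> q"
  shows "diam n q p \<le> diam n q p'"
proof (rule kolmogorov_diameter_greatest[OF absorbed_unit_balls[OF assms(2)]])
  fix t assume t: "approximable E n (unit_ball E q) (unit_ball E p') t"
  have "{smult E (of_real t) u + l | u l. u \<in> unit_ball E p' \<and> l \<in> L} \<subseteq>
      {smult E (of_real t) u + l | u l. u \<in> unit_ball E p \<and> l \<in> L}" for L
    using unit_ball_antimono[OF assms(1)] by blast
  then have "approximable E n (unit_ball E q) (unit_ball E p) t"
    using t unfolding approximable_def by (meson order_trans)
  then show "diam n q p \<le> t"
    using assms by (intro kolmogorov_diameter_le absorbed_unit_balls) auto
qed

lemma nbhd_of_zero_unit_ball: "nbhd_of_zero E (unit_ball E k)"
  unfolding nbhd_of_zero_def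
proof (intro conjI exI)
  show "unit_ball E k \<subseteq> carr E" by (rule unit_ball_subset_carr)
  let ?S = "{x \<in> carr E. snorm E k x < 1}"
  show "0 \<in> ?S" "?S \<subseteq> unit_ball E k" by (auto simp: unit_ball_def)
  have "\<exists>K r. finite K \<and> 0 < r \<and> {y \<in> carr E. \<forall>k\<in>K. snorm E k (y - x) < r} \<subseteq> ?S" if x: "x \<in> ?S" for x
  proof (intro exI conjI)
    show "finite {k}" "0 < 1 - snorm E k x" using x by auto
    show "{y \<in> carr E. \<forall>k'\<in>{k}. snorm E k' (y - x) < 1 - snorm E k x} \<subseteq> ?S"
    proof
      fix y assume y: "y \<in> {y \<in> carr E. \<forall>k'\<in>{k}. snorm E k' (y - x) < 1 - snorm E k x}"
      have "snorm E k y \<le> snorm E k (y - x) + snorm E k x"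
        using snorm_triangle[of "y - x" x k] x y by simp
      then show "y \<in> ?S" using y by auto
    qed
  qed
  then show "openin (seminorm_topology E) ?S"
    by (auto simp: openin_seminorm_topology seminorm_open_def)
qed

lemma nbhd_of_zero_contains_ball:
  assumes "nbhd_of_zero E U"
  shows "\<exists>p r. 0 < r \<and> {x \<in> carr E. snorm E p x \<le> r} \<subseteq> U"
proof -
  obtain S where S: "seminorm_open E S" "0 \<in> S" "S \<subseteq> U"
    using assms by (auto simp: nbhd_of_zero_def openin_seminorm_topology)
  obtain K r where K: "finite K" "0 < r" "{y \<in> carr E. \<forall>k\<in>K. snorm E k (y - 0) < r} \<subseteq> S"
    using S unfolding seminorm_open_def by blast
  obtain p where p: "\<And>k. k \<in> K \<Longrightarrow> k \<le> p"
    using K(1) by (meson finite_nat_set_iff_bounded_le)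
  have "{x \<in> carr E. snorm E p x \<le> r / 2} \<subseteq> U"
  proof
    fix x assume x: "x \<in> {x \<in> carr E. snorm E p x \<le> r / 2}"
    have "snorm E k x < r" if "k \<in> K" for k
      using snorm_mono[of x k p] p[OF that] x K(2) by fastforce
    then show "x \<in> U" using x K(3) S(3) by auto
  qed
  then show ?thesis using K(2) by (intro exI[of _ p] exI[of _ "r / 2"]) auto
qed

lemma bounded_subsetI:
  assumes "B \<subseteq> carr E" and bd: "\<And>k. \<exists>M. \<forall>x\<in>B. snorm E k x \<le> M"
  shows "bounded_subset E B"
  unfolding bounded_subset_def
proof (intro conjI allI impI)
  fix U assume "nbhd_of_zero E U"
  then obtain p r where r: "0 < r" "{x \<in> carr E. snorm E p x \<le> r} \<subseteq> U"
    using nbhd_of_zero_contains_ball by blast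
  obtain M where M: "\<And>x. x \<in> B \<Longrightarrow> snorm E p x \<le> M" using bd by blast
  define c where "c = max M 1 / r"
  have c: "0 < c" using r by (simp add: c_def)
  have "B \<subseteq> (\<lambda>u. smult E (of_real c) u) ` U"
  proof
    fix x assume x: "x \<in> B"
    have "snorm E p (smult E (of_real (1 / c)) x) = snorm E p x / c"
      using x assms(1) c by (subst snorm_scale) (auto simp: norm_divide)
    also have "\<dots> \<le> r"
      using M[OF x] r by (simp add: c_def field_simps max_def)
    finally have "smult E (of_real (1 / c)) x \<in> U"
      using x r assms(1) by auto
    then show "x \<in> (\<lambda>u. smult E (of_real c) u) ` U"
      using scale_cancel_of_real[of c x] c by (intro image_eqI[where x = "smult E (of_real (1 / c)) x"]) auto
  qed
  then show "\<exists>c>0. B \<subseteq> (\<lambda>u. smult E (of_real c) u) ` U" using c by blast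
qed (use assms in auto)

end

section \<open>Nuclear expansions and the approximate diametral dimension\<close>

text \<open>
  If each condition holds eventually, the index of the condition can be let grow slowly with \<open>n\<close>.
\<close>

lemma diagonal_eventually:
  fixes P :: "nat \<Rightarrow> nat \<Rightarrow> bool"
  assumes "\<And>q. eventually (P q) sequentially"
  shows "\<exists>g. filterlim g at_top sequentially \<and> eventually (\<lambda>n. P (g n) n) sequentially"
proof -
  obtain N where N: "\<And>q n. n \<ge> N q \<Longrightarrow> P q n"
    using assms unfolding eventually_sequentially by metis
  define A where "A n = {q. q \<le> n \<and> N q \<le> n}" for n
  define g where "g n = Max (A n)" for n
  have fin: "finite (A n)" for n
    by (rule finite_subset[of _ "{..n}"]) (auto simp: A_def)
  have ge: "q \<le> g n" if "max q (N q) \<le> n" for q n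
    unfolding g_def using that fin by (intro Max_ge) (auto simp: A_def)
  have "filterlim g at_top sequentially"
    unfolding filterlim_at_top eventually_sequentially using ge by blast
  moreover have "P (g n) n" if "N 0 \<le> n" for n
  proof -
    have "g n \<in> A n"
      unfolding g_def using fin that by (intro Max_in) (auto simp: A_def)
    then show ?thesis using N by (auto simp: A_def)
  qed
  ultimately show ?thesis unfolding eventually_sequentially by blast
qed

text \<open>
  The diameters of \<open>U\<^sub>q\<^sub>'\<close> can be seen, up to a factor independent of \<open>n\<close>, on bounded subsets \<open>Y\<close> of the
  larger ball \<open>U\<^sub>q\<close>. Such sets \<open>Y\<close> are the building blocks of the bounded set in the definition of the
  approximate diametral dimension.
\<close>

definition diameters_witnessed ::
    "('k::real_normed_field, 'a::ab_group_add) graded_space \<Rightarrow> bool" where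
  "diameters_witnessed E \<longleftrightarrow> (\<forall>q. \<exists>q'\<ge>q. \<exists>C>0. \<forall>p\<le>q. \<forall>n. \<exists>Y\<subseteq>unit_ball E q.
     (\<forall>k. bdd_above (snorm E k ` Y)) \<and>
     (\<forall>t. approximable E n Y (unit_ball E p) t \<longrightarrow>
        kolmogorov_diameter E n (unit_ball E q') (unit_ball E p) \<le> C * t))"

lemma approximable_subset:
  "approximable E n V U t \<Longrightarrow> W \<subseteq> V \<Longrightarrow> approximable E n W U t"
  unfolding approximable_def by blast

context seminormed_scale
begin

lemma norm_linear_form_le:
  assumes f: "linear_form E f" and fin: "dual_norm E q f < \<infinity>" and x: "x \<in> carr E"
  shows "norm (f x) \<le> enn2real (dual_norm E q f) * snorm E q x"
proof -
  define a where "a = enn2real (dual_norm E q f)"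
  have a: "dual_norm E q f = ennreal a" "0 \<le> a"
    using fin by (auto simp: a_def)
  have ball: "norm (f u) \<le> a" if "u \<in> unit_ball E q" for u
  proof -
    have "ennreal (norm (f u)) \<le> dual_norm E q f"
      unfolding dual_norm_def using that by (intro SUP_upper)
    then show ?thesis using a by simp
  qed
  have scaled: "norm (f x) \<le> a * c" if c: "snorm E q x \<le> c" "0 < c" for c
  proof -
    have "f (smult E (of_real (1 / c)) x) = of_real (1 / c) * f x"
      using f x by (auto simp: linear_form_def)
    moreover have "norm (f (smult E (of_real (1 / c)) x)) \<le> a"
      using ball scaled_mem_unit_ball[OF x c] by blast
    ultimately have "norm (of_real (1 / c) :: 'k) * norm (f x) \<le> a"
      by (simp only: norm_mult)
    then show ?thesis
      using c by (simp add: norm_divide field_simps)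
  qed
  show ?thesis
  proof (cases "snorm E q x = 0")
    case True
    have "norm (f x) \<le> 0 + e" if "0 < e" for e
    proof -
      have "norm (f x) \<le> a * (e / (a + 1))"
        using a that True by (intro scaled) auto
      also have "\<dots> \<le> e"
        using a that by (simp add: field_simps)
      finally show ?thesis by simp
    qed
    then have "norm (f x) \<le> 0" by (rule field_le_epsilon)
    then show ?thesis using True by simp
  next
    case False
    then show ?thesis
      using scaled[of "snorm E q x"] snorm_nonneg[OF x, of q] by (simp add: a_def)
  qed
qed

lemma nuclear_expansion:
  assumes "nuclear_canonical_map E q p"
  obtains f y a where "\<And>j. linear_form E (f j)" "\<And>j::nat. y j \<in> carr E" "\<And>j. 0 \<le> a j"
    "\<And>j x. x \<in> carr E \<Longrightarrow> norm (f j x) \<le> a j * snorm E q x"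
    "summable (\<lambda>j. a j * snorm E p (y j))"
    "\<And>x. x \<in> carr E \<Longrightarrow> (\<lambda>N. snorm E p (x - (\<Sum>j<N. smult E (f j x) (y j)))) \<longlonglongrightarrow> 0"
proof -
  obtain f :: "nat \<Rightarrow> 'a \<Rightarrow> 'k" and y where
    f: "\<And>j. linear_form E (f j)" "\<And>j. dual_norm E q (f j) < \<infinity>" "\<And>j. y j \<in> carr E" and
    sum: "(\<Sum>j. dual_norm E q (f j) * ennreal (snorm E p (y j))) < \<infinity>" and
    lim: "\<And>x. x \<in> carr E \<Longrightarrow> (\<lambda>N. snorm E p (x - (\<Sum>j<N. smult E (f j x) (y j)))) \<longlonglongrightarrow> 0"
    using assms unfolding nuclear_canonical_map_def by blast
  define a where "a j = enn2real (dual_norm E q (f j))" for j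
  have "dual_norm E q (f j) * ennreal (snorm E p (y j)) = ennreal (a j * snorm E p (y j))" for j
    using f(2)[of j] by (simp add: a_def ennreal_mult' f)
  then have "summable (\<lambda>j. a j * snorm E p (y j))"
    using sum f by (intro summable_suminf_not_top) (auto simp: a_def)
  then show thesis
    using that[of f y a] f lim norm_linear_form_le by (auto simp: a_def)
qed

lemma nuclear_canonical_map_mono:
  assumes "nuclear_canonical_map E q p" "q \<le> q'"
  shows "nuclear_canonical_map E q' p"
proof -
  have le: "dual_norm E q' f \<le> dual_norm E q f" for f
    unfolding dual_norm_def using unit_ball_antimono[OF assms(2)] by (intro SUP_subset_mono) auto
  obtain f :: "nat \<Rightarrow> 'a \<Rightarrow> 'k" and y where
    f: "\<And>j. linear_form E (f j)" "\<And>j. dual_norm E q (f j) < \<infinity>" "\<And>j. y j \<in> carr E" and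
    sum: "(\<Sum>j. dual_norm E q (f j) * ennreal (snorm E p (y j))) < \<infinity>" and
    lim: "\<forall>x\<in>carr E. (\<lambda>N. snorm E p (x - (\<Sum>j<N. smult E (f j x) (y j)))) \<longlonglongrightarrow> 0"
    using assms(1) unfolding nuclear_canonical_map_def by blast
  have "(\<Sum>j. dual_norm E q' (f j) * ennreal (snorm E p (y j))) \<le>
      (\<Sum>j. dual_norm E q (f j) * ennreal (snorm E p (y j)))"
    using le by (intro suminf_le mult_right_mono) auto
  then have "(\<Sum>j. dual_norm E q' (f j) * ennreal (snorm E p (y j))) < \<infinity>"
    using sum by (rule order.strict_trans1)
  moreover have "dual_norm E q' (f j) < \<infinity>" for j
    using f(2) le by (rule order.strict_trans1[rotated])
  ultimately show ?thesis
    unfolding nuclear_canonical_map_def using f lim by (intro exI[of _ f] exI[of _ y]) auto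
qed

text \<open>
  With the expansion \<open>x = \<Sum>\<^sub>j f\<^sub>j(x) y\<^sub>j\<close> of the canonical map, the ball \<open>U\<^sub>q\<^sub>'\<close> lies, up to closure,
  in a multiple of the absolutely convex hull of the normalized vectors \<open>y\<^sub>j / \<parallel>y\<^sub>j\<parallel>\<^sub>q\<close>, of which finitely many suffice
  up to an error smaller than the diameter that is to be bounded. A subspace close to these
  finitely many vectors is therefore close to all of \<open>U\<^sub>q\<^sub>'\<close>.
\<close>

lemma finite_witness:
  assumes nuc: "nuclear_canonical_map E q' q" and "q \<le> q'"
  shows "\<exists>C>0. \<forall>p\<le>q. \<forall>n. \<exists>Y\<subseteq>unit_ball E q. finite Y \<and>
    (\<forall>t. approximable E n Y (unit_ball E p) t \<longrightarrow> diam n q' p \<le> C * t)"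
proof -
  obtain f y a where f: "\<And>j. linear_form E (f j)" "\<And>j::nat. y j \<in> carr E" "\<And>j. 0 \<le> a j"
    "\<And>j x. x \<in> carr E \<Longrightarrow> norm (f j x) \<le> a j * snorm E q' x"
    "summable (\<lambda>j. a j * snorm E q (y j))"
    "\<And>x. x \<in> carr E \<Longrightarrow> (\<lambda>N. snorm E q (x - (\<Sum>j<N. smult E (f j x) (y j)))) \<longlonglongrightarrow> 0"
    by (rule nuclear_expansion[OF nuc], rule that)
  define b where "b j = a j * snorm E q (y j)" for j
  have b: "0 \<le> b j" "summable b" for j
    using f by (auto simp: b_def[abs_def])
  define A where "A = suminf b"
  have A: "0 \<le> A" "(\<Sum>j\<in>J. b j) \<le> A" if "finite J" for J
    using b that by (auto simp: A_def intro: suminf_nonneg sum_le_suminf)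
  show ?thesis
  proof (intro exI[of _ "2 * (A + 1)"] conjI allI impI)
    show "0 < 2 * (A + 1)" using A(1)[of "{}"] by simp
    fix p n assume p: "p \<le> q"
    let ?d = "diam n q' p"
    have absd: "absorbed E (unit_ball E q') (unit_ball E p)"
      using p assms(2) by (intro absorbed_unit_balls) auto
    show "\<exists>Y\<subseteq>unit_ball E q. finite Y \<and>
        (\<forall>t. approximable E n Y (unit_ball E p) t \<longrightarrow> ?d \<le> 2 * (A + 1) * t)"
    proof (cases "?d > 0")
      case False
      then have d: "?d = 0"
        using kolmogorov_diameter_nonneg[OF absd, of n] by simp
      show ?thesis
        unfolding d using A(1)[of "{}"] by (intro exI[of _ "{}"]) (auto simp: approximable_def)
    next
      case True
      \<comment> \<open>The truncation error and the error of the partial sum below are each kept at a quarter of the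
        diameter, so that they can be absorbed on the left-hand side.\<close>
      have tail: "(\<lambda>N. \<Sum>j. b (j + N)) \<longlonglongrightarrow> 0"
        using suminf_exist_split2[OF b(2)] by simp
      then obtain J where J: "(\<Sum>j. b (j + J)) < ?d / 4"
        using True order_tendstoD(2)[OF tail, of "?d / 4"] by (auto simp: eventually_sequentially)
      define Y where "Y = (\<lambda>j. smult E (of_real (1 / snorm E q (y j))) (y j)) ` {j. j < J \<and> snorm E q (y j) \<noteq> 0}"
      have Y: "Y \<subseteq> unit_ball E q"
      proof -
        have "smult E (of_real (1 / snorm E q (y j))) (y j) \<in> unit_ball E q" if "snorm E q (y j) \<noteq> 0" for j
          using that f(2) snorm_nonneg[OF f(2)[of j], of q] by (intro scaled_mem_unit_ball) (auto simp: less_le)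
        then show ?thesis by (auto simp: Y_def)
      qed
      have "?d \<le> 2 * (A + 1) * t" if t: "approximable E n Y (unit_ball E p) t" for t
      proof -
        have YE: "Y \<subseteq> carr E" using Y unit_ball_subset_carr by blast
        obtain F where F: "0 < t" "F \<subseteq> carr E" "finite F" "card F \<le> n"
            "\<forall>x\<in>Y. \<exists>l\<in>span F. snorm E p (x - l) \<le> t"
          using t unfolding approximable_unit_ball_iff[OF YE] by blast
        have "\<exists>l\<in>span F. snorm E p (y j - l) \<le> t * snorm E q (y j)" if "j < J" for j
        \<comment> \<open>Vectors of seminorm 0 cannot be normalized, but they are approximated by 0.\<close>
        proof (cases "snorm E q (y j) = 0")
          case True
          then have "snorm E p (y j - 0) \<le> t * snorm E q (y j)"
            using snorm_mono[OF f(2) p, of j] by simp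
          then show ?thesis using span_zero by blast
        next
          case False
          define c where "c = snorm E q (y j)"
          have c: "0 < c" using False snorm_nonneg[OF f(2)[of j], of q] by (simp add: c_def)
          have "smult E (of_real (1 / c)) (y j) \<in> Y"
            using False that by (auto simp: Y_def c_def)
          then obtain l where l: "l \<in> span F" "snorm E p (smult E (of_real (1 / c)) (y j) - l) \<le> t"
            using F(5) by blast
          have lc: "l \<in> carr E" using l span_subset_carr[OF F(2)] by blast
          have "y j - smult E (of_real c) l = smult E (of_real c) (smult E (of_real (1 / c)) (y j) - l)"
            using c scale_cancel_of_real[of c "y j"] by (simp add: scale_right_diff_distrib)
          then have "snorm E p (y j - smult E (of_real c) l) = c * snorm E p (smult E (of_real (1 / c)) (y j) - l)"
            using lc c f(2) by (simp add: snorm_scale)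
          also have "\<dots> \<le> t * c" using l c by simp
          finally show ?thesis using span_scale[OF l(1)] unfolding c_def by blast
        qed
        then obtain l where l: "\<And>j. j < J \<Longrightarrow> l j \<in> span F"
            "\<And>j. j < J \<Longrightarrow> snorm E p (y j - l j) \<le> t * snorm E q (y j)"
          by metis
        have lc: "l j \<in> carr E" if "j < J" for j
          using l(1)[OF that] span_subset_carr[OF F(2)] by blast
        have "\<exists>v\<in>span F. snorm E p (x - v) \<le> A * t + ?d / 2" if x: "x \<in> unit_ball E q'" for x
        proof -
          have xc: "x \<in> carr E" and fx: "norm (f j x) \<le> a j" for j
          proof -
            show "x \<in> carr E" using x by (auto simp: unit_ball_def)
            then have "norm (f j x) \<le> a j * snorm E q' x" by (rule f(4))
            also have "\<dots> \<le> a j" using x f(3) by (auto simp: unit_ball_def mult_left_le)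
            finally show "norm (f j x) \<le> a j" .
          qed
          define S where "S N = (\<Sum>j<N. smult E (f j x) (y j))" for N
          have "(\<lambda>N. snorm E q (x - S N)) \<longlonglongrightarrow> 0"
            using f(6)[OF xc] by (simp add: S_def)
          then have "eventually (\<lambda>N. snorm E q (x - S N) < ?d / 4) sequentially"
            using True by (intro order_tendstoD(2)) auto
          then obtain N where N: "snorm E q (x - S N) < ?d / 4" "N \<ge> J"
            unfolding eventually_sequentially by (meson nle_le)
          define v where "v = (\<Sum>j<J. smult E (f j x) (l j))"
          have Sc: "S N \<in> carr E" for N
            unfolding S_def using f(2) by (intro carr_sum) auto
          have vc: "v \<in> carr E"
            unfolding v_def using lc by (intro carr_sum) auto
          have b1: "snorm E p (smult E (f j x) z) \<le> a j * snorm E p z" if "z \<in> carr E" for j z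
            using that fx by (simp add: snorm_scale mult_right_mono)
          have "S N - S J = (\<Sum>j=J..<N. smult E (f j x) (y j))"
            using N(2) unfolding S_def
            by (metis atLeast0LessThan sum_diff_nat_ivl zero_le)
          then have "snorm E p (S N - S J) \<le> (\<Sum>j=J..<N. snorm E p (smult E (f j x) (y j)))"
            using f(2) by (simp add: snorm_sum)
          also have "\<dots> \<le> (\<Sum>j=J..<N. b j)"
          proof (rule sum_mono)
            fix j
            have "snorm E p (smult E (f j x) (y j)) \<le> a j * snorm E p (y j)"
              using b1 f(2) by blast
            also have "\<dots> \<le> b j"
              unfolding b_def using snorm_mono[OF f(2) p] f(3) by (intro mult_left_mono) auto
            finally show "snorm E p (smult E (f j x) (y j)) \<le> b j" .
          qed
          also have "\<dots> = (\<Sum>j<N - J. b (j + J))"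
            by (rule sum.reindex_bij_witness[of _ "\<lambda>j. j + J" "\<lambda>j. j - J"]) auto
          also have "\<dots> \<le> (\<Sum>j. b (j + J))"
            using b by (intro sum_le_suminf) (auto simp: summable_iff_shift)
          finally have t2: "snorm E p (S N - S J) \<le> ?d / 4" using J by simp
          have SJ: "S J - v = (\<Sum>j<J. smult E (f j x) (y j - l j))"
            by (simp add: S_def v_def scale_right_diff_distrib sum_subtractf)
          have "snorm E p (S J - v) \<le> (\<Sum>j<J. snorm E p (smult E (f j x) (y j - l j)))"
            unfolding SJ using f(2) lc by (intro snorm_sum) auto
          also have "\<dots> \<le> (\<Sum>j<J. t * b j)"
          proof (rule sum_mono)
            fix j assume j: "j \<in> {..<J}"
            have "snorm E p (smult E (f j x) (y j - l j)) \<le> a j * snorm E p (y j - l j)"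
              using b1 f(2) lc j by auto
            also have "\<dots> \<le> a j * (t * snorm E q (y j))"
              using l j f(3) by (intro mult_left_mono) auto
            finally show "snorm E p (smult E (f j x) (y j - l j)) \<le> t * b j"
              by (simp add: b_def mult_ac)
          qed
          also have "\<dots> \<le> A * t"
            using A(2)[of "{..<J}"] F(1) by (simp add: sum_distrib_left[symmetric] mult.commute)
          finally have t3: "snorm E p (S J - v) \<le> A * t" .
          have "x - v = (x - S N) + ((S N - S J) + (S J - v))" by simp
          then have "snorm E p (x - v) \<le> snorm E p (x - S N) + (snorm E p (S N - S J) + snorm E p (S J - v))"
            using snorm_triangle[of "x - S N" "(S N - S J) + (S J - v)" p]
              snorm_triangle[of "S N - S J" "S J - v" p] xc Sc vc by auto
          also have "snorm E p (x - S N) \<le> ?d / 4"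
            using snorm_mono[OF _ p, of "x - S N"] N(1) xc Sc by fastforce
          finally have "snorm E p (x - v) \<le> A * t + ?d / 2"
            using t2 t3 by simp
          moreover have "v \<in> span F"
            unfolding v_def using l by (intro span_sum span_scale) auto
          ultimately show ?thesis by blast
        qed
        then have "approximable E n (unit_ball E q') (unit_ball E p) (A * t + ?d / 2)"
          using F True A(1)[of "{}"]
          by (subst approximable_unit_ball_iff[OF unit_ball_subset_carr]) (auto intro: add_nonneg_pos)
        then have "?d \<le> A * t + ?d / 2"
          by (rule kolmogorov_diameter_le[OF absd])
        then show ?thesis using F(1) by (simp add: algebra_simps)
      qed
      then show ?thesis
        using Y by (intro exI[of _ Y]) (auto simp: Y_def)
    qed
  qed
qed

lemma nuclear_diameters_witnessed:
  assumes "nuclear_space E"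
  shows "diameters_witnessed E"
  unfolding diameters_witnessed_def
proof
  fix q
  obtain q1 where "nuclear_canonical_map E q1 q"
    using assms unfolding nuclear_space_def by blast
  then have "nuclear_canonical_map E (max q q1) q"
    by (rule nuclear_canonical_map_mono) simp
  then obtain C where C: "C > 0" "\<forall>p\<le>q. \<forall>n. \<exists>Y\<subseteq>unit_ball E q. finite Y \<and>
      (\<forall>t. approximable E n Y (unit_ball E p) t \<longrightarrow> diam n (max q q1) p \<le> C * t)"
    using finite_witness[of "max q q1" q] by auto
  show "\<exists>q'\<ge>q. \<exists>C>0. \<forall>p\<le>q. \<forall>n. \<exists>Y\<subseteq>unit_ball E q. (\<forall>k. bdd_above (snorm E k ` Y)) \<and>
      (\<forall>t. approximable E n Y (unit_ball E p) t \<longrightarrow> diam n q' p \<le> C * t)"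
  proof (intro exI[of _ "max q q1"] exI[of _ C] conjI allI impI)
    fix p n assume "p \<le> q"
    then obtain Y where "Y \<subseteq> unit_ball E q" "finite Y"
        "\<forall>t. approximable E n Y (unit_ball E p) t \<longrightarrow> diam n (max q q1) p \<le> C * t"
      using C(2) by blast
    then show "\<exists>Y\<subseteq>unit_ball E q. (\<forall>k. bdd_above (snorm E k ` Y)) \<and>
        (\<forall>t. approximable E n Y (unit_ball E p) t \<longrightarrow> diam n (max q q1) p \<le> C * t)"
      by (intro exI[of _ Y] conjI allI bdd_above_finite finite_imageI) auto
  qed (use C in auto)
qed

lemma approx_diametral_dimensionD:
  assumes "t \<in> approx_diametral_dimension E"
  obtains p where "\<And>q \<eta>. q \<ge> p \<Longrightarrow> 0 < \<eta> \<Longrightarrow> eventually (\<lambda>n. norm (t n) \<le> \<eta> * diam n q p) sequentially"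
proof -
  obtain U B where UB: "nbhd_of_zero E U" "bounded_subset E B"
      "(\<lambda>n. ennreal (norm (t n)) / ennreal (kolmogorov_diameter E n B U)) \<longlonglongrightarrow> 0"
    using assms unfolding approx_diametral_dimension_def by blast
  obtain p r where r: "0 < r" "{x \<in> carr E. snorm E p x \<le> r} \<subseteq> U"
    using nbhd_of_zero_contains_ball[OF UB(1)] by blast
  have "eventually (\<lambda>n. norm (t n) \<le> \<eta> * diam n q p) sequentially" if q: "q \<ge> p" and \<eta>: "0 < \<eta>" for q \<eta>
  proof -
    obtain c where c: "0 < c" "B \<subseteq> (\<lambda>u. smult E (of_real c) u) ` unit_ball E q"
      using UB(2) nbhd_of_zero_unit_ball[of q] unfolding bounded_subset_def by blast
    \<comment> \<open>The set \<open>B\<close> lies in \<open>c U\<^sub>q\<close> and \<open>r U\<^sub>p\<close> lies in \<open>U\<close>, so passing to the balls costs \<open>c / r\<close>.\<close>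
    have rU: "smult E (of_real r) u \<in> U" if "u \<in> unit_ball E p" for u
      using that r by (auto simp: unit_ball_def snorm_scale mult_left_le intro!: subsetD[OF r(2)])
    have "absorbed E B U"
      unfolding absorbed_def
    proof (intro exI[of _ "c / r"] conjI subsetI)
      show "0 < c / r" using c r by simp
      fix x assume "x \<in> B"
      then obtain u where u: "u \<in> unit_ball E q" "x = smult E (of_real c) u" using c by blast
      have "x = smult E (of_real (c / r)) (smult E (of_real r) u)"
        using u r scale_scale[of "of_real (c / r)" "of_real r" u]
        by (simp only: of_real_mult[symmetric]) simp
      then show "x \<in> (\<lambda>u. smult E (of_real (c / r)) u) ` U"
        using rU u(1) unit_ball_antimono[OF q] by blast
    qed
    have main: "kolmogorov_diameter E n B U \<le> (c / r) * diam n q p" for n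
    proof -
      have "(r / c) * kolmogorov_diameter E n B U \<le> diam n q p"
      proof (rule kolmogorov_diameter_greatest[OF absorbed_unit_balls[OF q]])
        fix s assume "approximable E n (unit_ball E q) (unit_ball E p) s"
        then obtain F where F: "0 < s" "F \<subseteq> carr E" "finite F" "card F \<le> n"
          "unit_ball E q \<subseteq> {smult E (of_real s) u + l | u l. u \<in> unit_ball E p \<and> l \<in> span F}"
          unfolding approximable_def by blast
        have "B \<subseteq> {smult E (of_real (c / r * s)) u + l | u l. u \<in> U \<and> l \<in> span F}"
        proof
          fix x assume "x \<in> B"
          then obtain u where u: "u \<in> unit_ball E q" "x = smult E (of_real c) u" using c by blast
          then obtain w l where w: "w \<in> unit_ball E p" "l \<in> span F" "u = smult E (of_real s) w + l"
            using F(5) by blast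
          have "x = smult E (of_real (c / r * s)) (smult E (of_real r) w) + smult E (of_real c) l"
            using u w r c by (simp add: scale_right_distrib)
          then show "x \<in> {smult E (of_real (c / r * s)) u + l | u l. u \<in> U \<and> l \<in> span F}"
            using rU[OF w(1)] span_scale[OF w(2)] by blast
        qed
        then have "approximable E n B U (c / r * s)"
          unfolding approximable_def using F c r by (intro conjI exI[of _ F]) auto
        then have "kolmogorov_diameter E n B U \<le> c / r * s"
          by (rule kolmogorov_diameter_le[OF \<open>absorbed E B U\<close>])
        then show "(r / c) * kolmogorov_diameter E n B U \<le> s"
          using c r by (simp add: field_simps)
      qed
      then show ?thesis using c r by (simp add: field_simps)
    qed
    define \<eta>' where "\<eta>' = \<eta> * r / c"
    have \<eta>': "0 < \<eta>'" using \<eta> c r by (simp add: \<eta>'_def)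
    have "eventually (\<lambda>n. ennreal (norm (t n)) / ennreal (kolmogorov_diameter E n B U) < ennreal \<eta>') sequentially"
      using UB(3) \<eta>' by (intro order_tendstoD(2)) auto
    then show ?thesis
    proof eventually_elim
      case (elim n)
      let ?d = "kolmogorov_diameter E n B U"
      have d0: "0 \<le> ?d" by (rule kolmogorov_diameter_nonneg[OF \<open>absorbed E B U\<close>])
      have "norm (t n) \<le> \<eta>' * ?d"
      proof (cases "?d = 0")
        case True
        then show ?thesis using elim by (cases "t n = 0") (auto simp: ennreal_divide_zero)
      next
        case False
        then have "norm (t n) / ?d < \<eta>'"
          using elim d0 \<eta>' by (simp add: divide_ennreal ennreal_less_iff)
        then show ?thesis using False d0 by (simp add: field_simps)
      qed
      also have "\<dots> \<le> \<eta>' * ((c / r) * diam n q p)"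
        using main \<eta>' by (intro mult_left_mono) auto
      also have "\<dots> = \<eta> * diam n q p"
        using c r by (simp add: \<eta>'_def)
      finally show ?case .
    qed
  qed
  then show thesis by (rule that)
qed

text \<open>
  The bounded set is a union of witnesses \<open>Y (g n) n \<subseteq> U\<^bsub>g n\<^esub>\<close>, where \<open>g n\<close> tends to infinity so
  slowly that the \<open>n\<close>-th estimate at level \<open>g n\<close> is already in force. For each \<open>k\<close> all but finitely
  many pieces lie in \<open>U\<^sub>k\<close>, so the union is bounded; and for all large \<open>n\<close> it contains a witness
  for the \<open>n\<close>-th diameter.
\<close>

lemma approx_diametral_dimensionI:
  assumes wit: "diameters_witnessed E"
    and t: "\<And>q \<eta>. q \<ge> p \<Longrightarrow> 0 < \<eta> \<Longrightarrow> eventually (\<lambda>n. norm (t n) \<le> \<eta> * diam n q p) sequentially"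
  shows "t \<in> approx_diametral_dimension E"
proof -
  obtain q' C where q': "\<And>q. q' q \<ge> q" "\<And>q. C q > 0"
    and ex: "\<And>q p n. p \<le> q \<Longrightarrow> \<exists>Y\<subseteq>unit_ball E q. (\<forall>k. bdd_above (snorm E k ` Y)) \<and>
      (\<forall>t. approximable E n Y (unit_ball E p) t \<longrightarrow> diam n (q' q) p \<le> C q * t)"
    using wit unfolding diameters_witnessed_def by metis
  obtain Y where Y: "\<And>q n. p \<le> q \<Longrightarrow> Y q n \<subseteq> unit_ball E q"
      "\<And>q n k. p \<le> q \<Longrightarrow> bdd_above (snorm E k ` Y q n)"
      "\<And>q n s. p \<le> q \<Longrightarrow> approximable E n (Y q n) (unit_ball E p) s \<Longrightarrow> diam n (q' q) p \<le> C q * s"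
    using ex[of p] by metis
  have "eventually (\<lambda>n. p \<le> q \<longrightarrow> norm (t n) \<le> (1 / (real (Suc q) * C q)) * diam n (q' q) p) sequentially" for q
  proof (cases "p \<le> q")
    case True
    then show ?thesis
      using t[of "q' q" "1 / (real (Suc q) * C q)"] q'[of q] by (auto simp: order_trans)
  qed auto
  then obtain g where g: "filterlim g at_top sequentially" "eventually (\<lambda>n. p \<le> g n \<longrightarrow>
      norm (t n) \<le> (1 / (real (Suc (g n)) * C (g n))) * diam n (q' (g n)) p) sequentially"
    using diagonal_eventually[of "\<lambda>q n. p \<le> q \<longrightarrow> norm (t n) \<le> (1 / (real (Suc q) * C q)) * diam n (q' q) p"]
    by blast
  define B where "B = (\<Union>n\<in>{n. p \<le> g n}. Y (g n) n)"
  have BE: "B \<subseteq> carr E"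
    using Y(1) unit_ball_subset_carr unfolding B_def by blast
  have Bb: "\<exists>M. \<forall>x\<in>B. snorm E k x \<le> M" for k
  proof -
    obtain N where N: "\<And>n. n \<ge> N \<Longrightarrow> k \<le> g n"
      using g(1) unfolding filterlim_at_top eventually_sequentially by blast
    have "\<forall>n. \<exists>M. p \<le> g n \<longrightarrow> (\<forall>x\<in>Y (g n) n. snorm E k x \<le> M)"
      using Y(2) unfolding bdd_above_def by (metis imageI)
    then obtain M where M: "\<And>n x. p \<le> g n \<Longrightarrow> x \<in> Y (g n) n \<Longrightarrow> snorm E k x \<le> M n"
      by metis
    have "snorm E k x \<le> max 1 (Max (M ` {..N}))" if x: "x \<in> B" for x
    proof -
      obtain n where n: "p \<le> g n" "x \<in> Y (g n) n" using x unfolding B_def by blast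
      show ?thesis
      proof (cases "n \<le> N")
        case True
        then have "snorm E k x \<le> Max (M ` {..N})"
          using M[OF n] by (intro order_trans[OF M[OF n] Max_ge]) auto
        then show ?thesis by simp
      next
        case False
        then have "x \<in> unit_ball E k"
          using n Y(1)[OF n(1), of n] N[of n] unit_ball_antimono[of k "g n"] by auto
        then show ?thesis by (auto simp: unit_ball_def)
      qed
    qed
    then show ?thesis by blast
  qed
  have bdd: "bounded_subset E B"
    using BE Bb by (rule bounded_subsetI)
  have absB: "absorbed E B (unit_ball E p)"
    using Bb[of p] BE absorbed_unit_ball by blast
  let ?D = "\<lambda>n. kolmogorov_diameter E n B (unit_ball E p)"
  have low: "diam n (q' (g n)) p \<le> C (g n) * ?D n" if n: "p \<le> g n" for n
  proof -
    have "diam n (q' (g n)) p / C (g n) \<le> ?D n"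
    proof (rule kolmogorov_diameter_greatest[OF absB])
      fix s assume "approximable E n B (unit_ball E p) s"
      then have "approximable E n (Y (g n) n) (unit_ball E p) s"
        using n by (elim approximable_subset) (auto simp: B_def)
      then show "diam n (q' (g n)) p / C (g n) \<le> s"
        using Y(3)[OF n] q'(2)[of "g n"] by (simp add: field_simps)
    qed
    then show ?thesis using q'(2)[of "g n"] by (simp add: field_simps)
  qed
  have le: "eventually (\<lambda>n. ennreal (norm (t n)) / ennreal (?D n) \<le> ennreal (1 / real (Suc (g n)))) sequentially"
  proof -
    have "eventually (\<lambda>n. p \<le> g n) sequentially"
      using g(1) unfolding filterlim_at_top by blast
    with g(2) show ?thesis
    proof eventually_elim
      case (elim n)
      have "norm (t n) \<le> (1 / (real (Suc (g n)) * C (g n))) * diam n (q' (g n)) p"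
        using elim by blast
      also have "\<dots> \<le> (1 / (real (Suc (g n)) * C (g n))) * (C (g n) * ?D n)"
        using low elim q'(2)[of "g n"] by (intro mult_left_mono) auto
      also have "\<dots> = 1 / real (Suc (g n)) * ?D n"
        using q'(2)[of "g n"] by simp
      finally have *: "norm (t n) \<le> 1 / real (Suc (g n)) * ?D n" .
      show ?case
      proof (cases "?D n = 0")
        case True
        then show ?thesis using * by simp
      next
        case False
        then have D: "0 < ?D n"
          using kolmogorov_diameter_nonneg[OF absB, of n] by simp
        then have "norm (t n) / ?D n \<le> 1 / real (Suc (g n))"
          using * by (simp add: field_simps)
        then show ?thesis
          using D by (simp add: divide_ennreal ennreal_leI)
      qed
    qed
  qed
  have "(\<lambda>n. 1 / real (Suc (g n))) \<longlonglongrightarrow> 0"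
    using filterlim_compose[OF LIMSEQ_inverse_real_of_nat g(1)] by (simp add: inverse_eq_divide)
  then have "(\<lambda>n. ennreal (1 / real (Suc (g n)))) \<longlonglongrightarrow> ennreal 0"
    by (rule tendsto_ennrealI)
  then have "(\<lambda>n. ennreal (norm (t n)) / ennreal (?D n)) \<longlonglongrightarrow> 0"
    using le by (intro tendsto_sandwich[OF _ le tendsto_const]) auto
  then show ?thesis
    unfolding approx_diametral_dimension_def using bdd nbhd_of_zero_unit_ball by blast
qed

end

section \<open>Diameters under the interpolation inequality\<close>

context seminormed_scale
begin

lemma span_determined_by_linear_forms:
  fixes c :: "'z \<Rightarrow> 'k"
  assumes lin: "linear_form E g" "\<And>z. z \<in> Z \<Longrightarrow> linear_form E (h z)"
    and F: "F \<subseteq> carr E" "\<And>l. l \<in> F \<Longrightarrow> g l = (\<Sum>z\<in>Z. c z * h z l)"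
    and l: "l \<in> span F"
  shows "g l = (\<Sum>z\<in>Z. c z * h z l)"
proof -
  have "subspace {l \<in> carr E. g l = (\<Sum>z\<in>Z. c z * h z l)}"
  proof (rule subspaceI)
    have "g (smult E 0 0) = 0 * g 0" "\<And>z. z \<in> Z \<Longrightarrow> h z (smult E 0 0) = 0 * h z 0"
      using lin carr_closed(1) unfolding linear_form_def by blast+
    then show "0 \<in> {l \<in> carr E. g l = (\<Sum>z\<in>Z. c z * h z l)}"
      by simp
  next
    fix x y assume xy: "x \<in> {l \<in> carr E. g l = (\<Sum>z\<in>Z. c z * h z l)}"
      "y \<in> {l \<in> carr E. g l = (\<Sum>z\<in>Z. c z * h z l)}"
    have "(\<Sum>z\<in>Z. c z * h z (x + y)) = (\<Sum>z\<in>Z. c z * h z x + c z * h z y)"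
      using lin(2) xy by (intro sum.cong) (auto simp: linear_form_def algebra_simps)
    then show "x + y \<in> {l \<in> carr E. g l = (\<Sum>z\<in>Z. c z * h z l)}"
      using lin(1) xy by (auto simp: linear_form_def sum.distrib)
  next
    fix a x assume x: "x \<in> {l \<in> carr E. g l = (\<Sum>z\<in>Z. c z * h z l)}"
    have "(\<Sum>z\<in>Z. c z * h z (smult E a x)) = (\<Sum>z\<in>Z. a * (c z * h z x))"
      using lin(2) x by (intro sum.cong) (auto simp: linear_form_def)
    then show "smult E a x \<in> {l \<in> carr E. g l = (\<Sum>z\<in>Z. c z * h z l)}"
      using lin(1) x by (auto simp: linear_form_def sum_distrib_left)
  qed
  then have "span F \<subseteq> {l \<in> carr E. g l = (\<Sum>z\<in>Z. c z * h z l)}"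
    using F by (intro span_minimal) auto
  then show ?thesis using l by blast
qed

lemma linear_form_diff:
  assumes "linear_form E f" "x \<in> carr E" "y \<in> carr E"
  shows "f (x - y) = f x - f y"
proof -
  have "f ((x - y) + y) = f (x - y) + f y"
    using assms carr_closed(3)[OF assms(2,3)] unfolding linear_form_def by blast
  then show ?thesis by simp
qed

lemma linear_form_sum:
  assumes f: "linear_form E f" and I: "finite I" "\<And>i. i \<in> I \<Longrightarrow> x i \<in> carr E"
  shows "f (\<Sum>i\<in>I. smult E (c i) (x i)) = (\<Sum>i\<in>I. c i * f (x i))"
  using I
proof (induction I rule: finite_induct)
  case empty
  have "f (smult E 0 0) = 0 * f 0"
    using f carr_closed(1) unfolding linear_form_def by blast
  then show ?case by simp
next
  case (insert i I)
  have "f (smult E (c i) (x i) + (\<Sum>i\<in>I. smult E (c i) (x i))) =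
      c i * f (x i) + f (\<Sum>i\<in>I. smult E (c i) (x i))"
    using f insert.prems carr_sum[of I "\<lambda>i. smult E (c i) (x i)"] by (auto simp: linear_form_def)
  then show ?case using insert by simp
qed

text \<open>
  From an approximating subspace to few linear forms. Regard the spanning vectors \<open>l\<close> of the subspace as
  functions \<open>j \<mapsto> f\<^sub>j(l) / a\<^sub>j\<close> on the indices of the expansion. The spanning points are at most \<open>n\<close>
  indices, and on the subspace every normalized form is a combination of the selected ones with
  coefficients at most 2. If the selected forms vanish at \<open>x \<in> U\<^sub>k\<close>, they are at most \<open>t\<close> at the
  approximant of \<open>x\<close>; hence every normalized form is at most \<open>2 n t\<close> at the approximant and
  \<open>(2 n + 1) t\<close> at \<open>x\<close>, and summing the expansion bounds the seminorm.
\<close>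

lemma few_forms_controlling_seminorm:
  assumes f: "\<And>j::nat. linear_form E (f j)" "\<And>j. y j \<in> carr E" "\<And>j. 0 \<le> a j"
      "\<And>j x. x \<in> carr E \<Longrightarrow> norm (f j x) \<le> a j * snorm E p1 x"
      "summable (\<lambda>j. a j * snorm E p (y j))"
      "\<And>x. x \<in> carr E \<Longrightarrow> (\<lambda>N. snorm E p (x - (\<Sum>j<N. smult E (f j x) (y j)))) \<longlonglongrightarrow> 0"
    and le: "p \<le> k"
    and app: "approximable E n (unit_ball E k) (unit_ball E p1) t"
  shows "\<exists>Z. finite Z \<and> card Z \<le> n \<and> (\<forall>x\<in>carr E. (\<forall>z\<in>Z. f z x = 0) \<longrightarrow>
    snorm E p x \<le> (2 * real n + 1) * t * (\<Sum>j. a j * snorm E p (y j)) * snorm E k x)"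
proof -
  obtain F where F: "0 < t" "F \<subseteq> carr E" "finite F" "card F \<le> n"
      "\<forall>x\<in>unit_ball E k. \<exists>l\<in>span F. snorm E p1 (x - l) \<le> t"
    using app unfolding approximable_unit_ball_iff[OF unit_ball_subset_carr] by blast
  define A where "A = (\<Sum>j. a j * snorm E p (y j))"
  define h where "h j x = f j x / of_real (a j)" for j x
  have h: "linear_form E (h j)" for j
    using f(1)[of j] by (auto simp: linear_form_def h_def add_divide_distrib)
  have h1: "norm (h j x) \<le> snorm E p1 x" if "x \<in> carr E" "0 < a j" for j x
    using f(4)[OF that(1), of j] that by (simp add: h_def norm_divide field_simps)
  define X where "X = {j. 0 < a j}"
  have "\<exists>Z\<subseteq>X. finite Z \<and> card Z \<le> card ((\<lambda>l j. h j l) ` F) \<and>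
    (\<forall>j\<in>X. \<exists>c. (\<forall>z\<in>Z. norm (c z) \<le> 2) \<and> (\<forall>g\<in>(\<lambda>l j. h j l) ` F. g j = (\<Sum>z\<in>Z. c z * g z)))"
  proof (rule bounded_spanning_points)
    show "finite ((\<lambda>l j. h j l) ` F)" using F by simp
    fix g assume "g \<in> (\<lambda>l j. h j l) ` F"
    then obtain l where "l \<in> F" "g = (\<lambda>j. h j l)" by blast
    then show "\<exists>M. \<forall>j\<in>X. norm (g j) \<le> M"
      using h1 F(2) by (intro exI[of _ "snorm E p1 l"]) (auto simp: X_def)
  qed
  then obtain Z where Z: "Z \<subseteq> X" "finite Z" "card Z \<le> card ((\<lambda>l j. h j l) ` F)"
    and span: "\<And>j. j \<in> X \<Longrightarrow> \<exists>c. (\<forall>z\<in>Z. norm (c z) \<le> 2) \<and> (\<forall>l\<in>F. h j l = (\<Sum>z\<in>Z. c z * h z l))"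
    by auto
  have card: "card Z \<le> n"
    using Z(3) card_image_le[OF F(3), of "\<lambda>l j. h j l"] F(4) by simp
  have ball: "snorm E p x \<le> (2 * real n + 1) * t * A"
    if x: "x \<in> unit_ball E k" and zero: "\<forall>z\<in>Z. f z x = 0" for x
  proof -
    obtain l where l: "l \<in> span F" "snorm E p1 (x - l) \<le> t"
      using F(5) x by blast
    have carr: "x \<in> carr E" "l \<in> carr E"
      using x unit_ball_subset_carr l span_subset_carr[OF F(2)] by auto
    have dl: "norm (h j x - h j l) \<le> t" if "j \<in> X" for j
    proof -
      have "norm (h j (x - l)) \<le> t"
        using h1[of "x - l" j] that carr l(2) by (auto simp: X_def)
      then show ?thesis by (simp add: linear_form_diff[OF h] carr)
    qed
    have fj: "norm (f j x) \<le> a j * ((2 * real n + 1) * t)" for j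
    proof (cases "j \<in> X")
      case True
      obtain c where c: "\<And>z. z \<in> Z \<Longrightarrow> norm (c z) \<le> 2" "\<And>l. l \<in> F \<Longrightarrow> h j l = (\<Sum>z\<in>Z. c z * h z l)"
        using span[OF True] by blast
      have "h j l = (\<Sum>z\<in>Z. c z * h z l)"
        using span_determined_by_linear_forms[where h = h and c = c, OF h h F(2) c(2) l(1)] .
      then have "norm (h j l) \<le> (\<Sum>z\<in>Z. norm (c z) * norm (h z l))"
        using norm_sum[of "\<lambda>z. c z * h z l" Z] by (simp add: norm_mult)
      also have "\<dots> \<le> (\<Sum>z\<in>Z. 2 * t)"
      proof (rule sum_mono)
        fix z assume z: "z \<in> Z"
        have "norm (h z l) \<le> t"
          using dl[of z] z Z(1) zero by (auto simp: h_def)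
        then show "norm (c z) * norm (h z l) \<le> 2 * t"
          using c(1)[OF z] by (intro mult_mono) auto
      qed
      also have "\<dots> \<le> 2 * real n * t"
        using card F(1) by simp
      finally have "norm (h j x) \<le> 2 * real n * t + t"
        using dl[OF True] norm_triangle_ineq2[of "h j x" "h j l"] by simp
      then show ?thesis
        using True by (simp add: h_def X_def norm_divide field_simps)
    next
      case False
      then have "a j = 0" using f(3)[of j] by (simp add: X_def)
      then show ?thesis using f(4)[OF carr(1), of j] by simp
    qed
    have "snorm E p x \<le> snorm E p (x - (\<Sum>j<N. smult E (f j x) (y j))) + (2 * real n + 1) * t * A" for N
    proof -
      let ?S = "\<Sum>j<N. smult E (f j x) (y j)"
      have Sc: "?S \<in> carr E" using f(2) by (intro carr_sum) auto
      have "snorm E p x \<le> snorm E p (x - ?S) + snorm E p ?S"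
        using snorm_triangle[of "x - ?S" ?S p] carr Sc by simp
      also have "snorm E p ?S \<le> (\<Sum>j<N. snorm E p (smult E (f j x) (y j)))"
        using f(2) by (intro snorm_sum) auto
      also have "\<dots> \<le> (\<Sum>j<N. (2 * real n + 1) * t * (a j * snorm E p (y j)))"
      proof (rule sum_mono)
        fix j
        show "snorm E p (smult E (f j x) (y j)) \<le> (2 * real n + 1) * t * (a j * snorm E p (y j))"
          using mult_right_mono[OF fj[of j] snorm_nonneg[OF f(2)[of j], of p]] f(2)
          by (simp add: snorm_scale mult_ac)
      qed
      also have "\<dots> \<le> (2 * real n + 1) * t * A"
        unfolding sum_distrib_left[symmetric] A_def using f F(1)
        by (intro mult_left_mono sum_le_suminf) auto
      finally show ?thesis by simp
    qed
    moreover have "(\<lambda>N. snorm E p (x - (\<Sum>j<N. smult E (f j x) (y j))) + (2 * real n + 1) * t * A)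
        \<longlonglongrightarrow> 0 + (2 * real n + 1) * t * A"
      using f(6)[OF carr(1)] by (intro tendsto_intros)
    ultimately show ?thesis
      using LIMSEQ_le_const by force
  qed
  have "snorm E p x \<le> (2 * real n + 1) * t * A * snorm E k x"
    if x: "x \<in> carr E" and zero: "\<forall>z\<in>Z. f z x = 0" for x
  proof (cases "snorm E k x = 0")
    case True
    then show ?thesis using snorm_mono[OF x le] by simp
  next
    case False
    define c where "c = snorm E k x"
    have c: "0 < c" using False snorm_nonneg[OF x, of k] by (simp add: c_def)
    have "smult E (of_real (1 / c)) x \<in> unit_ball E k"
      using x c by (intro scaled_mem_unit_ball) (auto simp: c_def)
    moreover have "\<forall>z\<in>Z. f z (smult E (of_real (1 / c)) x) = 0"
      using zero f(1) x by (auto simp: linear_form_def)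
    ultimately have "snorm E p (smult E (of_real (1 / c)) x) \<le> (2 * real n + 1) * t * A"
      by (rule ball)
    then show ?thesis
      using x c by (simp add: snorm_scale norm_divide field_simps flip: c_def)
  qed
  then show ?thesis
    using Z card by (auto simp: A_def)
qed

text \<open>
  From few linear forms back to an approximating subspace. The spanning points for the forms on \<open>U\<^sub>m\<close> span a
  complement of the common kernel, and the projection \<open>x \<mapsto> x - \<Sum> c\<^sub>w w\<close> to the kernel has norm
  at most \<open>2 n + 1\<close>.
\<close>

lemma approximable_of_small_on_kernel:
  assumes f: "\<And>z. z \<in> Z \<Longrightarrow> linear_form E (f z)"
      "\<And>z. z \<in> Z \<Longrightarrow> \<exists>M. \<forall>x\<in>unit_ball E m. norm (f z x) \<le> M"
    and Z: "finite Z" "card Z \<le> n" and K: "0 < K"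
    and small: "\<And>x. x \<in> carr E \<Longrightarrow> \<forall>z\<in>Z. f z x = 0 \<Longrightarrow> snorm E k x \<le> K * snorm E m x"
  shows "approximable E n (unit_ball E m) (unit_ball E k) ((2 * real n + 1) * K)"
proof -
  have "\<exists>W\<subseteq>unit_ball E m. finite W \<and> card W \<le> card (f ` Z) \<and>
    (\<forall>x\<in>unit_ball E m. \<exists>c. (\<forall>w\<in>W. norm (c w) \<le> 2) \<and> (\<forall>g\<in>f ` Z. g x = (\<Sum>w\<in>W. c w * g w)))"
    using Z(1) f(2) by (intro bounded_spanning_points) auto
  then obtain W where W: "W \<subseteq> unit_ball E m" "finite W" "card W \<le> card (f ` Z)"
    and span: "\<And>x. x \<in> unit_ball E m \<Longrightarrow>
      \<exists>c. (\<forall>w\<in>W. norm (c w) \<le> 2) \<and> (\<forall>z\<in>Z. f z x = (\<Sum>w\<in>W. c w * f z w))"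
    by auto
  have card: "card W \<le> n"
    using W(3) card_image_le[OF Z(1), of f] Z(2) by simp
  have WE: "W \<subseteq> carr E" using W(1) unit_ball_subset_carr by blast
  have "\<exists>l\<in>span W. snorm E k (x - l) \<le> (2 * real n + 1) * K" if x: "x \<in> unit_ball E m" for x
  proof -
    obtain c where c: "\<And>w. w \<in> W \<Longrightarrow> norm (c w) \<le> 2" "\<And>z. z \<in> Z \<Longrightarrow> f z x = (\<Sum>w\<in>W. c w * f z w)"
      using span[OF x] by blast
    define l where "l = (\<Sum>w\<in>W. smult E (c w) w)"
    have carr: "x \<in> carr E" "l \<in> carr E"
      using x unit_ball_subset_carr WE by (auto simp: l_def intro!: carr_sum)
    have "snorm E m l \<le> (\<Sum>w\<in>W. snorm E m (smult E (c w) w))"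
      unfolding l_def using W WE by (intro snorm_sum) auto
    also have "\<dots> \<le> (\<Sum>w\<in>W. 2 * 1)"
    proof (rule sum_mono)
      fix w assume w: "w \<in> W"
      then have "snorm E m w \<le> 1" "w \<in> carr E" using W(1) by (auto simp: unit_ball_def)
      then show "snorm E m (smult E (c w) w) \<le> 2 * 1"
        using c(1)[OF w] by (subst snorm_scale) (auto intro: mult_mono simp del: mult_1_right)
    qed
    also have "\<dots> \<le> 2 * real n" using card by simp
    finally have "snorm E m (x - l) \<le> 1 + 2 * real n"
      using snorm_diff[OF carr, of m] x by (auto simp: unit_ball_def)
    moreover have "f z l = (\<Sum>w\<in>W. c w * f z w)" if "z \<in> Z" for z
      unfolding l_def using linear_form_sum[OF f(1)[OF that] W(2), of "\<lambda>w. w" c] WE by auto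
    then have "\<forall>z\<in>Z. f z (x - l) = 0"
      using f(1) carr c(2) by (simp add: linear_form_diff)
    then have "snorm E k (x - l) \<le> K * snorm E m (x - l)"
      using small carr by blast
    ultimately have "snorm E k (x - l) \<le> K * (1 + 2 * real n)"
      using K by (meson mult_left_mono less_imp_le order_trans)
    moreover have "l \<in> span W"
      unfolding l_def by (intro span_sum span_scale span_base)
    ultimately show ?thesis by (auto simp: algebra_simps)
  qed
  then show ?thesis
    unfolding approximable_unit_ball_iff[OF unit_ball_subset_carr]
    using K W(2) WE card by (intro conjI exI[of _ W]) (auto simp: add_nonneg_pos)
qed

text \<open>
  On the kernel of the selected forms \<open>\<parallel>x\<parallel>\<^sub>p\<^sub>0 \<le> D \<parallel>x\<parallel>\<^sub>k\<close> with \<open>D\<close> of order \<open>n \<delta>\<close>. Inserting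
  this into the interpolation inequality and cancelling \<open>\<parallel>x\<parallel>\<^sub>k\<^bsup>1 - \<tau>\<^esup>\<close> leaves
  \<open>\<parallel>x\<parallel>\<^sub>k \<le> C\<^bsup>1/\<tau>\<^esup> D\<^bsup>s\<^esup> \<parallel>x\<parallel>\<^sub>m\<close> with \<open>s = (1 - \<tau>) / \<tau>\<close>. The index \<open>p\<close> exceeds the index
  \<open>p\<^sub>0\<close> of the inequality so far that the canonical map from \<open>p\<close> to \<open>p\<^sub>0\<close> is nuclear and supplies forms.
\<close>

lemma DN_diameters:
  assumes "has_DN E" and "nuclear_space E"
  shows "\<exists>p. \<forall>k>p. \<exists>m\<ge>k. \<exists>C>0. \<exists>s>0. \<forall>n \<delta>. diam n k p < \<delta> \<longrightarrow>
    diam n m k \<le> C * (2 * real n + 1) powr (1 + s) * \<delta> powr s"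
proof -
  obtain p0 where DN: "\<And>k. k > p0 \<Longrightarrow> \<exists>m>k. \<exists>\<tau> C. 0 < \<tau> \<and> \<tau> < 1 \<and> 0 < C \<and>
     (\<forall>x\<in>carr E. snorm E k x \<le> C * snorm E p0 x powr (1 - \<tau>) * snorm E m x powr \<tau>)"
    using assms(1) unfolding has_DN_def by blast
  obtain p1 where "nuclear_canonical_map E p1 p0"
    using assms(2) unfolding nuclear_space_def by blast
  define p where "p = max p0 p1"
  have nuc: "nuclear_canonical_map E p p0"
    using \<open>nuclear_canonical_map E p1 p0\<close> by (rule nuclear_canonical_map_mono) (simp add: p_def)
  obtain f y a where f: "\<And>j. linear_form E (f j)" "\<And>j::nat. y j \<in> carr E" "\<And>j. 0 \<le> a j"
    "\<And>j x. x \<in> carr E \<Longrightarrow> norm (f j x) \<le> a j * snorm E p x"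
    "summable (\<lambda>j. a j * snorm E p0 (y j))"
    "\<And>x. x \<in> carr E \<Longrightarrow> (\<lambda>N. snorm E p0 (x - (\<Sum>j<N. smult E (f j x) (y j)))) \<longlonglongrightarrow> 0"
    by (rule nuclear_expansion[OF nuc], rule that)
  define A where "A = (\<Sum>j. a j * snorm E p0 (y j)) + 1"
  have A: "0 < A" "(\<Sum>j. a j * snorm E p0 (y j)) \<le> A"
    using suminf_nonneg[OF f(5)] f by (auto simp: A_def add_nonneg_pos)
  show ?thesis
  proof (rule exI[of _ p], intro allI impI)
    fix k assume k: "p < k"
    then obtain m \<tau> C where m: "k < m" "0 < \<tau>" "\<tau> < 1" "0 < C"
        "\<And>x. x \<in> carr E \<Longrightarrow> snorm E k x \<le> C * snorm E p0 x powr (1 - \<tau>) * snorm E m x powr \<tau>"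
      using DN[of k] by (auto simp: p_def)
    define s where "s = (1 - \<tau>) / \<tau>"
    have s: "0 < s" using m by (simp add: s_def)
    have main: "diam n m k \<le> (C powr (1 / \<tau>) * A powr s) * (2 * real n + 1) powr (1 + s) * \<delta> powr s"
      if \<delta>: "diam n k p < \<delta>" for n \<delta>
    proof -
      obtain t where t: "t < \<delta>" "approximable E n (unit_ball E k) (unit_ball E p) t"
        using approximable_of_kolmogorov_diameter_less[OF absorbed_unit_balls \<delta>] k by auto
      have t0: "0 < t" using t(2) by (simp add: approximable_def)
      have "\<exists>Z. finite Z \<and> card Z \<le> n \<and> (\<forall>x\<in>carr E. (\<forall>z\<in>Z. f z x = 0) \<longrightarrow>
          snorm E p0 x \<le> (2 * real n + 1) * t * (\<Sum>j. a j * snorm E p0 (y j)) * snorm E k x)"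
        using k by (intro few_forms_controlling_seminorm[OF f _ t(2)]) (auto simp: p_def)
      then obtain Z where Z: "finite Z" "card Z \<le> n"
          "\<And>x. x \<in> carr E \<Longrightarrow> \<forall>z\<in>Z. f z x = 0 \<Longrightarrow>
            snorm E p0 x \<le> (2 * real n + 1) * t * (\<Sum>j. a j * snorm E p0 (y j)) * snorm E k x"
        by blast
      define D where "D = (2 * real n + 1) * \<delta> * A"
      have D: "0 < D" using t t0 A by (simp add: D_def)
      define K where "K = C powr (1 / \<tau>) * D powr s"
      have K: "0 < K" using m D by (simp add: K_def)
      have small: "snorm E k x \<le> K * snorm E m x" if x: "x \<in> carr E" and zero: "\<forall>z\<in>Z. f z x = 0" for x
      proof (cases "snorm E k x = 0")
        case True
        then show ?thesis using x K by simp
      next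
        case False
        define u where "u = snorm E k x"
        have u: "0 < u" using False snorm_nonneg[OF x, of k] by (simp add: u_def)
        define w where "w = snorm E m x"
        have w: "0 < w" using snorm_mono[OF x, of k m] m u by (simp add: u_def w_def)
        have "snorm E p0 x \<le> (2 * real n + 1) * t * (\<Sum>j. a j * snorm E p0 (y j)) * u"
          using Z(3)[OF x zero] by (simp add: u_def)
        also have "\<dots> \<le> (2 * real n + 1) * \<delta> * A * u"
          using t t0 A u suminf_nonneg[OF f(5)] f by (intro mult_right_mono mult_mono) auto
        finally have "snorm E p0 x \<le> D * u" by (simp add: D_def)
        then have "snorm E p0 x powr (1 - \<tau>) \<le> (D * u) powr (1 - \<tau>)"
          using x m by (intro powr_mono2) auto
        then have "u \<le> C * (D * u) powr (1 - \<tau>) * w powr \<tau>"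
          using m(5)[OF x] m(4) unfolding u_def[symmetric] w_def[symmetric]
          by (meson mult_left_mono mult_right_mono order_trans powr_ge_zero less_imp_le)
        also have "\<dots> = (C * D powr (1 - \<tau>) * w powr \<tau>) * u powr (1 - \<tau>)"
          using D u by (simp add: powr_mult)
        finally have "u powr \<tau> * u powr (1 - \<tau>) \<le> (C * D powr (1 - \<tau>) * w powr \<tau>) * u powr (1 - \<tau>)"
          using u by (simp flip: powr_add)
        then have "u powr \<tau> \<le> C * D powr (1 - \<tau>) * w powr \<tau>"
          using u by simp
        then have "(u powr \<tau>) powr (1 / \<tau>) \<le> (C * D powr (1 - \<tau>) * w powr \<tau>) powr (1 / \<tau>)"
          using m by (intro powr_mono2) auto
        then show ?thesis
          using u w m D by (simp add: powr_powr powr_mult K_def s_def flip: u_def w_def)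
      qed
      have "approximable E n (unit_ball E m) (unit_ball E k) ((2 * real n + 1) * K)"
      proof (rule approximable_of_small_on_kernel[where f = f and Z = Z])
        fix z
        have "norm (f z x) \<le> a z" if "x \<in> unit_ball E m" for x
        proof -
          have "snorm E p x \<le> 1"
            using that snorm_mono[of x p m] m(1) k by (fastforce simp: unit_ball_def)
          then show ?thesis
            using f(4)[of x z] f(3)[of z] that mult_left_le[of "snorm E p x" "a z"]
            by (auto simp: unit_ball_def)
        qed
        then show "\<exists>M. \<forall>x\<in>unit_ball E m. norm (f z x) \<le> M" by blast
      qed (use f Z K small in auto)
      then have "diam n m k \<le> (2 * real n + 1) * K"
        using m by (intro kolmogorov_diameter_le absorbed_unit_balls) auto
      also have "\<dots> = (C powr (1 / \<tau>) * A powr s) * (2 * real n + 1) powr (1 + s) * \<delta> powr s"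
        using t t0 A by (simp add: K_def D_def powr_mult powr_add)
      finally show ?thesis .
    qed
    have "0 < C powr (1 / \<tau>) * A powr s" using m A by simp
    then show "\<exists>m\<ge>k. \<exists>C>0. \<exists>s>0. \<forall>n \<delta>. diam n k p < \<delta> \<longrightarrow>
        diam n m k \<le> C * (2 * real n + 1) powr (1 + s) * \<delta> powr s"
      using m(1) s main by (meson less_imp_le)
  qed
qed

end

section \<open>Weighted sup spaces\<close>

lemma frequently_diagonal:
  fixes P :: "nat \<Rightarrow> nat \<Rightarrow> bool"
  assumes "\<And>q. frequently (P q) sequentially"
  shows "\<exists>r. strict_mono r \<and> (\<forall>j. P j (r j))"
proof -
  have "\<exists>n\<ge>N. P q n" for q N
    using assms[of q] by (auto simp: frequently_def eventually_sequentially)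
  then have ex: "\<exists>n>m. P q n" for q m
    by (meson Suc_le_lessD)
  have "\<exists>r. \<forall>j. P j (r j) \<and> r (Suc j) > r j"
    using ex by (intro dependent_nat_choice) blast+
  then show ?thesis by (auto simp: strict_mono_Suc_iff)
qed

lemma eventually_exp_uminus_le:
  assumes "exponent_sequence \<epsilon>" "0 < \<eta>"
  shows "eventually (\<lambda>n. exp (- \<epsilon> n) \<le> \<eta>) sequentially"
proof -
  have "eventually (\<lambda>n. - ln \<eta> \<le> \<epsilon> n) sequentially"
    using assms(1) unfolding exponent_sequence_def filterlim_at_top by blast
  then show ?thesis
  proof eventually_elim
    case (elim n)
    then have "exp (- \<epsilon> n) \<le> exp (ln \<eta>)" by (subst exp_le_cancel_iff) simp
    then show ?case using assms(2) by simp
  qed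
qed

lemma sum_fun_apply: "(\<Sum>i\<in>A. f i) x = (\<Sum>i\<in>A. f i x)"
  for f :: "'i \<Rightarrow> 'x \<Rightarrow> 'b::comm_monoid_add"
  by (induction A rule: infinite_finite_induct) auto

definition unit_seq :: "nat \<Rightarrow> nat \<Rightarrow> 'k::real_normed_field" where
  "unit_seq i = (\<lambda>m. if m = i then 1 else 0)"

lemma sum_unit_seq_apply:
  "finite I \<Longrightarrow> (\<Sum>i\<in>I. (\<lambda>m. c i * unit_seq i m)) m = (if m \<in> I then c m else 0)"
  by (simp add: sum_fun_apply unit_seq_def if_distrib[of "\<lambda>z. _ * z"] sum.delta' cong: if_cong)

lemma weighted_sup_space_simps [simp]:
  "carr (weighted_sup_space a) = {x. \<forall>k. bdd_above (range (\<lambda>n. norm (x n) * a k n))}"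
  "smult (weighted_sup_space a) = (\<lambda>c x n. c * x n)"
  by (simp_all add: weighted_sup_space_def)

lemma weighted_snorm_upper:
  assumes "x \<in> carr (weighted_sup_space a)"
  shows "norm (x n) * a k n \<le> snorm (weighted_sup_space a) k x"
  using assms by (auto simp: weighted_sup_space_def intro: cSUP_upper)

lemma weighted_snorm_least:
  assumes "\<And>n. norm (x n) * a k n \<le> M"
  shows "snorm (weighted_sup_space a) k x \<le> M"
  using assms by (auto simp: weighted_sup_space_def intro: cSUP_least)

lemma weighted_carrI:
  assumes "\<And>k. \<exists>M. \<forall>n. norm (x n) * a k n \<le> M"
  shows "x \<in> carr (weighted_sup_space a)"
  using assms by (auto simp: bdd_above_def)

lemma finite_support_weighted_carr:
  assumes "\<And>m. m > n \<Longrightarrow> x m = 0"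
  shows "x \<in> carr (weighted_sup_space a)"
proof (rule weighted_carrI)
  fix k
  have "norm (x m) * a k m \<le> max 0 (Max ((\<lambda>m. norm (x m) * a k m) ` {..n}))" for m
    by (cases "m \<le> n") (auto simp: assms not_le intro!: max.coboundedI2)
  then show "\<exists>M. \<forall>m. norm (x m) * a k m \<le> M" by blast
qed

lemma weighted_seminormed_scale:
  fixes a :: "nat \<Rightarrow> nat \<Rightarrow> real"
  assumes pos: "\<And>k n. 0 < a k n" and inc: "\<And>k n. a k n \<le> a (Suc k) n"
  shows "seminormed_scale (weighted_sup_space a :: ('k::real_normed_field, nat \<Rightarrow> 'k) graded_space)"
proof -
  let ?E = "weighted_sup_space a :: ('k, nat \<Rightarrow> 'k) graded_space"
  interpret vector_space "smult ?E"
    by unfold_locales (auto simp: algebra_simps)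
  have add: "norm ((x + y) n) * a k n \<le> snorm ?E k x + snorm ?E k y"
    if "x \<in> carr ?E" "y \<in> carr ?E" for x y k n
  proof -
    have "norm ((x + y) n) * a k n \<le> norm (x n) * a k n + norm (y n) * a k n"
      using mult_right_mono[OF norm_triangle_ineq[of "x n" "y n"] less_imp_le[OF pos[of k n]]]
      by (simp add: distrib_right)
    then show ?thesis
      using weighted_snorm_upper[OF that(1), of n k] weighted_snorm_upper[OF that(2), of n k] by simp
  qed
  have scale: "norm (smult ?E c x n) * a k n \<le> norm c * snorm ?E k x"
    if "x \<in> carr ?E" for c x k n
    using mult_left_mono[OF weighted_snorm_upper[OF that, of n k] norm_ge_zero[of c]]
    by (simp add: norm_mult mult.assoc)
  have scarr: "smult ?E c x \<in> carr ?E" if "x \<in> carr ?E" for c x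
    using scale[OF that] by (intro weighted_carrI) blast
  show ?thesis
  proof
    show "subspace (carr ?E)"
    proof (rule subspaceI)
      show "0 \<in> carr ?E" by (intro weighted_carrI exI[of _ 0]) auto
      show "x + y \<in> carr ?E" if "x \<in> carr ?E" "y \<in> carr ?E" for x y
        using add[OF that] by (intro weighted_carrI) blast
    qed (rule scarr)
    fix k
    show "seminorm_on ?E (snorm ?E k)"
      unfolding seminorm_on_def
    proof (intro conjI ballI allI)
      show "snorm ?E k (x + y) \<le> snorm ?E k x + snorm ?E k y" if "x \<in> carr ?E" "y \<in> carr ?E" for x y
        using add[OF that] by (rule weighted_snorm_least)
      show "snorm ?E k (smult ?E c x) = norm c * snorm ?E k x" if x: "x \<in> carr ?E" for c x
      proof (rule antisym)
        show "snorm ?E k (smult ?E c x) \<le> norm c * snorm ?E k x"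
          using scale[OF x] by (rule weighted_snorm_least)
        show "norm c * snorm ?E k x \<le> snorm ?E k (smult ?E c x)"
        proof (cases "c = 0")
          case True
          have "0 \<le> norm (smult ?E c x 0) * a k 0"
            using pos[of k 0] by simp
          also have "\<dots> \<le> snorm ?E k (smult ?E c x)"
            using weighted_snorm_upper[OF scarr[OF x]] by blast
          finally show ?thesis using True by simp
        next
          case False
          have "snorm ?E k (smult ?E (1 / c) (smult ?E c x)) \<le> norm (1 / c) * snorm ?E k (smult ?E c x)"
            using scale[OF scarr[OF x]] by (rule weighted_snorm_least)
          moreover have "smult ?E (1 / c) (smult ?E c x) = x" using False by simp
          ultimately show ?thesis using False by (simp add: norm_divide field_simps)
        qed
      qed
    qed
    fix x assume x: "x \<in> carr ?E"
    show "snorm ?E k x \<le> snorm ?E (Suc k) x"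
    proof (rule weighted_snorm_least)
      fix n
      have "norm (x n) * a k n \<le> norm (x n) * a (Suc k) n"
        using inc by (intro mult_left_mono) auto
      then show "norm (x n) * a k n \<le> snorm ?E (Suc k) x"
        using weighted_snorm_upper[OF x, of n "Suc k"] by simp
    qed
  qed
qed

text \<open>
  A box in the first \<open>n + 1\<close> coordinates is not close to any \<open>n\<close>-dimensional subspace. The spanning
  points for the coordinate values of the \<open>n\<close> spanning vectors are at most \<open>n\<close> coordinates, so
  another coordinate is a combination of them on the whole subspace. This is a linear form
  annihilating the subspace, and the vertex \<open>x\<close> of the box whose phases are aligned with the form
  norms it.
\<close>

lemma box_not_approximable:
  fixes a :: "nat \<Rightarrow> nat \<Rightarrow> real"
  defines "E \<equiv> (weighted_sup_space a :: ('k::real_normed_field, nat \<Rightarrow> 'k) graded_space)"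
  assumes pos: "\<And>k n. 0 < a k n" and inc: "\<And>k n. a k n \<le> a (Suc k) n"
    and c: "\<And>i. i \<le> n \<Longrightarrow> c \<le> a p i / a q i"
    and app: "approximable E n {x. (\<forall>i>n. x i = 0) \<and> (\<forall>i\<le>n. norm (x i) * a q i \<le> 1)} (unit_ball E p) t"
  shows "c \<le> t"
proof -
  interpret seminormed_scale E
    unfolding E_def using pos inc by (rule weighted_seminormed_scale)
  let ?Y = "{x. (\<forall>i>n. x i = (0::'k)) \<and> (\<forall>i\<le>n. norm (x i) * a q i \<le> 1)}"
  have YE: "?Y \<subseteq> carr E"
    unfolding E_def using finite_support_weighted_carr by blast
  obtain F where F: "0 < t" "F \<subseteq> carr E" "finite F" "card F \<le> n"
      "\<forall>x\<in>?Y. \<exists>l\<in>span F. snorm E p (x - l) \<le> t"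
    using app unfolding approximable_unit_ball_iff[OF YE] by blast
  have "\<exists>Z\<subseteq>{..n}. finite Z \<and> card Z \<le> card F \<and>
    (\<forall>i\<in>{..n}. \<exists>c. (\<forall>z\<in>Z. norm (c z) \<le> 2) \<and> (\<forall>v\<in>F. v i = (\<Sum>z\<in>Z. c z * v z)))"
  proof (rule bounded_spanning_points[OF F(3)])
    fix v
    show "\<exists>M. \<forall>i\<in>{..n}. norm (v i) \<le> M"
      by (intro exI[of _ "Max ((\<lambda>i. norm (v i)) ` {..n})"]) auto
  qed
  then obtain Z where Z: "Z \<subseteq> {..n}" "finite Z" "card Z \<le> card F"
    and span: "\<And>i. i \<le> n \<Longrightarrow> \<exists>c. \<forall>v\<in>F. v i = (\<Sum>z\<in>Z. c z * v z)"
    by (auto simp: Ball_def) metis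
  have "card Z < card {..n}" using Z(3) F(4) by simp
  then obtain i where i: "i \<le> n" "i \<notin> Z"
    using card_mono[OF Z(2), of "{..n}"] by (meson atMost_iff not_le subsetI)
  obtain d where d: "\<And>v. v \<in> F \<Longrightarrow> v i = (\<Sum>z\<in>Z. d z * v z)"
    using span[OF i(1)] by blast
  have lin: "linear_form E (\<lambda>v. v j)" for j
    by (simp add: linear_form_def E_def)
  have ann: "l i = (\<Sum>z\<in>Z. d z * l z)" if "l \<in> span F" for l
    using span_determined_by_linear_forms[where g = "\<lambda>v. v i" and h = "\<lambda>z v. v z" and c = d, OF lin lin F(2) d that] .
  \<comment> \<open>The annihilating form is \<open>v \<mapsto> v\<^sub>i - \<Sum> d\<^sub>z v\<^sub>z\<close>; the phases of \<open>x\<close> make all its terms positive.\<close>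
  define x where "x m = (if m = i then of_real (1 / a q i)
      else if m \<in> Z \<and> d m \<noteq> 0 then - of_real (norm (d m) / a q m) / d m else 0)" for m
  have "x \<in> ?Y"
    using pos i(1) Z(1) by (auto simp: x_def norm_divide norm_mult less_imp_neq[THEN not_sym] less_imp_le)
  then obtain l where l: "l \<in> span F" "snorm E p (x - l) \<le> t"
    using F(5) by blast
  have carr: "x - l \<in> carr E"
    using \<open>x \<in> ?Y\<close> YE l span_subset_carr[OF F(2)] by blast
  have u: "norm ((x - l) m) \<le> t / a p m" for m
    using weighted_snorm_upper[of "x - l" a m p] carr l(2) pos[of p m] by (simp add: E_def field_simps)
  define S where "S = 1 / a p i + (\<Sum>z\<in>Z. norm (d z) / a p z)"
  have S: "0 < S"
    unfolding S_def using pos by (intro add_pos_nonneg sum_nonneg) (auto simp: less_imp_le)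
  have dx: "d z * x z = - of_real (norm (d z) / a q z)" if "z \<in> Z" for z
    using that i(2) by (auto simp: x_def)
  have "(x - l) i - (\<Sum>z\<in>Z. d z * (x - l) z) = x i - (\<Sum>z\<in>Z. d z * x z)"
    using ann[OF l(1)] by (simp add: algebra_simps sum_subtractf)
  also have "\<dots> = of_real (1 / a q i + (\<Sum>z\<in>Z. norm (d z) / a q z))"
    using dx by (simp add: x_def sum_negf)
  finally have eq: "(x - l) i - (\<Sum>z\<in>Z. d z * (x - l) z) =
      of_real (1 / a q i + (\<Sum>z\<in>Z. norm (d z) / a q z))" .
  have ge: "c / a p j \<le> 1 / a q j" if "j \<le> n" for j
    using c[OF that] pos[of p j] pos[of q j] by (simp add: field_simps)
  have "c * S = c / a p i + (\<Sum>z\<in>Z. norm (d z) * (c / a p z))"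
    by (simp add: S_def distrib_left sum_distrib_left mult_ac)
  also have "\<dots> \<le> 1 / a q i + (\<Sum>z\<in>Z. norm (d z) * (1 / a q z))"
    using ge i Z(1) by (intro add_mono sum_mono mult_left_mono) auto
  also have "\<dots> \<le> norm ((x - l) i - (\<Sum>z\<in>Z. d z * (x - l) z))"
    unfolding eq norm_of_real by simp
  also have "\<dots> \<le> norm ((x - l) i) + (\<Sum>z\<in>Z. norm (d z) * norm ((x - l) z))"
    using norm_triangle_ineq4[of "(x - l) i" "\<Sum>z\<in>Z. d z * (x - l) z"]
      norm_sum[of "\<lambda>z. d z * (x - l) z" Z] by (simp add: norm_mult)
  also have "\<dots> \<le> t / a p i + (\<Sum>z\<in>Z. norm (d z) * (t / a p z))"
    using u by (intro add_mono sum_mono mult_left_mono) auto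
  also have "\<dots> = t * S"
    by (simp add: S_def distrib_left sum_distrib_left mult_ac)
  finally show ?thesis using S by simp
qed

context
  fixes \<epsilon> :: "nat \<Rightarrow> real"
  assumes exponent: "exponent_sequence \<epsilon>"
begin

lemma exponent_nonneg: "0 \<le> \<epsilon> n" and exponent_mono: "m \<le> n \<Longrightarrow> \<epsilon> m \<le> \<epsilon> n"
  using exponent by (auto simp: exponent_sequence_def mono_def)

lemma Lambda_inf_seminormed_scale:
  "seminormed_scale (Lambda_inf \<epsilon> :: ('k::real_normed_field, nat \<Rightarrow> 'k) graded_space)"
  unfolding Lambda_inf_def using exponent_nonneg
  by (intro weighted_seminormed_scale) (auto intro: mult_right_mono)

lemma Lambda_1_seminormed_scale:
  "seminormed_scale (Lambda_1 \<epsilon> :: ('k::real_normed_field, nat \<Rightarrow> 'k) graded_space)"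
  unfolding Lambda_1_def using exponent_nonneg
  by (intro weighted_seminormed_scale) (auto intro!: divide_left_mono)

text \<open>
  A trace estimate. The first \<open>n + 1\<close> diagonal entries of the canonical map are 1, so \<open>n + 1\<close> equals
  \<open>\<Sum>\<^sub>j \<Sum>\<^sub>i f\<^sub>j(e\<^sub>i) (y\<^sub>j)\<^sub>i\<close>. As the weights are at most 1, testing \<open>f\<^sub>j\<close> on a sum of unit vectors
  with suitable phases bounds \<open>\<Sum>\<^sub>i \<bar>f\<^sub>j(e\<^sub>i)\<bar>\<close> by the dual norm of \<open>f\<^sub>j\<close>, and \<open>\<bar>(y\<^sub>j)\<^sub>i\<bar>\<close> is at
  most \<open>exp \<epsilon>\<^sub>n\<close> times the lowest norm of \<open>y\<^sub>j\<close>.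
\<close>

lemma nuclear_Lambda_1_growth:
  assumes "nuclear_space (Lambda_1 \<epsilon> :: ('k::real_normed_field, nat \<Rightarrow> 'k) graded_space)"
  shows "\<exists>C. \<forall>n. real (Suc n) \<le> C * exp (\<epsilon> n)"
proof -
  define a where "a k n = exp (- \<epsilon> n / real (Suc k))" for k n
  define E where "E = (weighted_sup_space a :: ('k, nat \<Rightarrow> 'k) graded_space)"
  have E: "Lambda_1 \<epsilon> = E" by (simp add: Lambda_1_def E_def a_def[abs_def])
  interpret seminormed_scale E
    using Lambda_1_seminormed_scale[where 'k = 'k] by (simp add: E)
  obtain q where nuc: "nuclear_canonical_map E q 0"
    using assms unfolding E nuclear_space_def by blast
  obtain f y b where f: "\<And>j. linear_form E (f j)" "\<And>j::nat. y j \<in> carr E" "\<And>j. 0 \<le> b j"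
    "\<And>j x. x \<in> carr E \<Longrightarrow> norm (f j x) \<le> b j * snorm E q x"
    "summable (\<lambda>j. b j * snorm E 0 (y j))"
    "\<And>x. x \<in> carr E \<Longrightarrow> (\<lambda>N. snorm E 0 (x - (\<Sum>j<N. smult E (f j x) (y j)))) \<longlonglongrightarrow> 0"
    by (rule nuclear_expansion[OF nuc], rule that)
  define A where "A = (\<Sum>j. b j * snorm E 0 (y j))"
  have apos: "0 < a k n" and ale: "a k n \<le> 1" for k n
    using exponent_nonneg[of n] by (auto simp: a_def)
  have unit: "unit_seq i \<in> carr E" for i
    unfolding E_def by (rule finite_support_weighted_carr[of i]) (auto simp: unit_seq_def)
  have sm: "smult E c x m = c * x m" for c x m by (simp add: E_def)
  have "real (Suc n) \<le> A * exp (\<epsilon> n)" for n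
  proof -
    define T where "T N = (\<Sum>i\<le>n. \<Sum>j<N. f j (unit_seq i) * y j i)" for N
    have coord: "(\<lambda>N. \<Sum>j<N. f j (unit_seq i) * y j i) \<longlonglongrightarrow> 1" for i
    proof -
      let ?S = "\<lambda>N. \<Sum>j<N. smult E (f j (unit_seq i)) (y j)"
      have Sc: "?S N \<in> carr E" for N using f(2) by (intro carr_sum) auto
      have le: "norm ((unit_seq i - ?S N) i) \<le> snorm E 0 (unit_seq i - ?S N) / a 0 i" for N
        using weighted_snorm_upper[of "unit_seq i - ?S N" a i 0] carr_closed(3)[OF unit Sc] apos[of 0 i]
        unfolding E_def[symmetric] by (simp add: pos_le_divide_eq)
      have "(\<lambda>N. snorm E 0 (unit_seq i - ?S N) / a 0 i) \<longlonglongrightarrow> 0"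
        using f(6)[OF unit] by (rule tendsto_divide_zero)
      then have "(\<lambda>N. (unit_seq i - ?S N) i) \<longlonglongrightarrow> 0"
        by (rule Lim_null_comparison[OF always_eventually[OF allI[OF le]]])
      then have "(\<lambda>N. 1 - (unit_seq i - ?S N) i) \<longlonglongrightarrow> 1 - 0"
        by (intro tendsto_intros)
      moreover have "1 - (unit_seq i - ?S N) i = (\<Sum>j<N. f j (unit_seq i) * y j i)" for N
        by (simp add: sum_fun_apply sm unit_seq_def)
      ultimately show ?thesis by simp
    qed
    have T: "T \<longlonglongrightarrow> (\<Sum>i\<le>n. 1)"
      unfolding T_def[abs_def] by (intro tendsto_sum coord)
    have bound: "norm (T N) \<le> A * exp (\<epsilon> n)" for N
    proof -
      have fsum: "(\<Sum>i\<le>n. norm (f j (unit_seq i))) \<le> b j" for j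
      proof -
        \<comment> \<open>The phase that turns \<open>f\<^sub>j(e\<^sub>i)\<close> into its norm.\<close>
        define \<theta> where "\<theta> i = (if f j (unit_seq i) = 0 then 0 else of_real (norm (f j (unit_seq i))) / f j (unit_seq i))" for i
        define x where "x = (\<Sum>i\<le>n. smult E (\<theta> i) (unit_seq i))"
        have xc: "x \<in> carr E" unfolding x_def using unit by (intro carr_sum) auto
        have xm: "x m = (if m \<le> n then \<theta> m else 0)" for m
          unfolding x_def E_def using sum_unit_seq_apply[of "{..n}" \<theta> m] by simp
        have "f j x = (\<Sum>i\<le>n. \<theta> i * f j (unit_seq i))"
          unfolding x_def using unit by (intro linear_form_sum f) auto
        also have "\<dots> = of_real (\<Sum>i\<le>n. norm (f j (unit_seq i)))"
          unfolding of_real_sum by (intro sum.cong) (auto simp: \<theta>_def)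
        finally have "(\<Sum>i\<le>n. norm (f j (unit_seq i))) \<le> norm (f j x)"
          by (simp del: of_real_sum)
        also have "\<dots> \<le> b j * snorm E q x" using xc by (rule f(4))
        also have "snorm E q x \<le> 1"
          unfolding E_def
        proof (rule weighted_snorm_least)
          fix m
          have "norm (x m) \<le> 1" by (simp add: xm \<theta>_def norm_divide)
          then show "norm (x m) * a q m \<le> 1"
            using ale[of q m] apos[of q m] by (simp add: mult_le_one)
        qed
        finally show ?thesis using f(3)[of j] by (simp add: mult_left_mono)
      qed
      have yb: "norm (y j i) \<le> snorm E 0 (y j) * exp (\<epsilon> n)" if "i \<le> n" for i j
      proof -
        have "norm (y j i) \<le> snorm E 0 (y j) * exp (\<epsilon> i)"
          using weighted_snorm_upper[of "y j" a i 0] f(2)[of j] unfolding E_def[symmetric]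
          by (simp add: a_def exp_minus field_simps)
        also have "\<dots> \<le> snorm E 0 (y j) * exp (\<epsilon> n)"
          using exponent_mono[OF that] f(2) by (intro mult_left_mono) auto
        finally show ?thesis .
      qed
      have "norm (T N) = norm (\<Sum>j<N. \<Sum>i\<le>n. f j (unit_seq i) * y j i)"
        unfolding T_def by (subst sum.swap) simp
      also have "\<dots> \<le> (\<Sum>j<N. \<Sum>i\<le>n. norm (f j (unit_seq i)) * (snorm E 0 (y j) * exp (\<epsilon> n)))"
        using yb by (intro sum_norm_le order_trans[OF norm_sum] sum_mono) (auto simp: norm_mult intro: mult_left_mono)
      also have "\<dots> = (\<Sum>j<N. (\<Sum>i\<le>n. norm (f j (unit_seq i))) * (snorm E 0 (y j) * exp (\<epsilon> n)))"
        by (simp add: sum_distrib_right)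
      also have "\<dots> \<le> (\<Sum>j<N. b j * (snorm E 0 (y j) * exp (\<epsilon> n)))"
        using fsum f(2) by (intro sum_mono mult_right_mono) auto
      also have "\<dots> = (\<Sum>j<N. b j * snorm E 0 (y j)) * exp (\<epsilon> n)"
        by (simp add: sum_distrib_right mult.assoc)
      also have "\<dots> \<le> A * exp (\<epsilon> n)"
        unfolding A_def using f by (intro mult_right_mono sum_le_suminf) auto
      finally show ?thesis .
    qed
    have "norm (\<Sum>i\<le>n. (1::'k)) \<le> A * exp (\<epsilon> n)"
      using tendsto_norm[OF T] bound by (intro LIMSEQ_le_const2) auto
    then show ?thesis by (simp add: norm_of_nat del: of_nat_Suc)
  qed
  then show ?thesis by blast
qed

end

section \<open>Power series spaces of infinite type\<close>

context
  fixes \<epsilon> :: "nat \<Rightarrow> real"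
  assumes exponent: "exponent_sequence \<epsilon>"
begin

lemma Lambda_inf_box:
  fixes p q n :: nat and t :: real
  assumes "p \<le> q"
  defines "Y \<equiv> {x :: nat \<Rightarrow> 'k::real_normed_field.
    (\<forall>i>n. x i = 0) \<and> (\<forall>i\<le>n. norm (x i) * exp (real (Suc q) * \<epsilon> i) \<le> 1)}"
  shows "Y \<subseteq> unit_ball (Lambda_inf \<epsilon>) q"
    and "\<And>k. bdd_above (snorm (Lambda_inf \<epsilon>) k ` Y)"
    and "approximable (Lambda_inf \<epsilon>) n Y (unit_ball (Lambda_inf \<epsilon>) p) t \<Longrightarrow>
      exp (- (real q - real p) * \<epsilon> n) \<le> t"
proof -
  show "Y \<subseteq> unit_ball (Lambda_inf \<epsilon>) q"
  proof
    fix x assume x: "x \<in> Y"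
    have "norm (x i) * exp (real (Suc q) * \<epsilon> i) \<le> 1" for i
      using x by (cases "i \<le> n") (auto simp: Y_def)
    moreover have "x \<in> carr (Lambda_inf \<epsilon>)"
      unfolding Lambda_inf_def using x by (intro finite_support_weighted_carr[of n]) (auto simp: Y_def)
    ultimately show "x \<in> unit_ball (Lambda_inf \<epsilon>) q"
      unfolding unit_ball_def Lambda_inf_def by (auto intro: weighted_snorm_least)
  qed
  show "bdd_above (snorm (Lambda_inf \<epsilon>) k ` Y)" for k
  proof (rule bdd_aboveI2)
    fix x assume x: "x \<in> Y"
    show "snorm (Lambda_inf \<epsilon>) k x \<le> exp (real (Suc k) * \<epsilon> n)"
      unfolding Lambda_inf_def
    proof (rule weighted_snorm_least)
      fix i
      show "norm (x i) * exp (real (Suc k) * \<epsilon> i) \<le> exp (real (Suc k) * \<epsilon> n)"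
      proof (cases "i \<le> n")
        case True
        have "norm (x i) * 1 \<le> norm (x i) * exp (real (Suc q) * \<epsilon> i)"
          using exponent_nonneg[OF exponent, of i] by (intro mult_left_mono) auto
        also have "\<dots> \<le> 1" using x True by (auto simp: Y_def)
        finally have "norm (x i) * exp (real (Suc k) * \<epsilon> i) \<le> 1 * exp (real (Suc k) * \<epsilon> n)"
          using exponent_mono[OF exponent True] by (intro mult_mono) (auto intro: mult_left_mono)
        then show ?thesis by simp
      next
        case False
        then show ?thesis using x by (auto simp: Y_def)
      qed
    qed
  qed
  show "exp (- (real q - real p) * \<epsilon> n) \<le> t"
    if app: "approximable (Lambda_inf \<epsilon>) n Y (unit_ball (Lambda_inf \<epsilon>) p) t"
  proof (rule box_not_approximable[where a = "\<lambda>k n. exp (real (Suc k) * \<epsilon> n)" and p = p and q = q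
        and n = n and 'k = 'k])
    show "exp (real (Suc k) * \<epsilon> m) \<le> exp (real (Suc (Suc k)) * \<epsilon> m)" for k m
      using exponent_nonneg[OF exponent, of m] by (auto intro: mult_right_mono)
    fix i assume "i \<le> n"
    then have "(real q - real p) * \<epsilon> i \<le> (real q - real p) * \<epsilon> n"
      using assms(1) exponent_mono[OF exponent] by (intro mult_left_mono) auto
    then show "exp (- (real q - real p) * \<epsilon> n) \<le> exp (real (Suc p) * \<epsilon> i) / exp (real (Suc q) * \<epsilon> i)"
      by (simp add: exp_diff[symmetric] algebra_simps)
  qed (use app in \<open>simp_all add: Lambda_inf_def Y_def\<close>)
qed

text \<open>
  The first \<open>n\<close> unit vectors span an optimal subspace, as the exponents increase.
\<close>

lemma Lambda_inf_approximable:
  assumes "p \<le> q"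
  shows "approximable (Lambda_inf \<epsilon> :: ('k::real_normed_field, nat \<Rightarrow> 'k) graded_space) n
    (unit_ball (Lambda_inf \<epsilon>) q) (unit_ball (Lambda_inf \<epsilon>) p) (exp (- (real q - real p) * \<epsilon> n))"
proof -
  define E where "E = (Lambda_inf \<epsilon> :: ('k, nat \<Rightarrow> 'k) graded_space)"
  interpret seminormed_scale E
    unfolding E_def by (rule Lambda_inf_seminormed_scale[OF exponent])
  define F :: "(nat \<Rightarrow> 'k) set" where "F = unit_seq ` {..<n}"
  have FE: "F \<subseteq> carr E"
    unfolding F_def E_def Lambda_inf_def
    by (intro image_subsetI finite_support_weighted_carr[where n = n]) (auto simp: unit_seq_def)
  have "\<exists>l\<in>span F. snorm E p (x - l) \<le> exp (- (real q - real p) * \<epsilon> n)" if x: "x \<in> unit_ball E q" for x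
  proof
    define l where "l = (\<Sum>i<n. smult E (x i) (unit_seq i))"
    show "l \<in> span F"
      unfolding l_def F_def by (intro span_sum span_scale span_base) auto
    have lm: "l m = (if m < n then x m else 0)" for m
      unfolding l_def E_def Lambda_inf_def using sum_unit_seq_apply[of "{..<n}" x m] by simp
    have xm: "norm (x m) * exp (real (Suc q) * \<epsilon> m) \<le> 1" for m
    proof -
      have "x \<in> carr E" "snorm E q x \<le> 1" using x by (auto simp: unit_ball_def)
      then show ?thesis
        using weighted_snorm_upper[of x "\<lambda>k n. exp (real (Suc k) * \<epsilon> n)" m q]
        unfolding E_def Lambda_inf_def by linarith
    qed
    show "snorm E p (x - l) \<le> exp (- (real q - real p) * \<epsilon> n)"
      unfolding E_def Lambda_inf_def
    proof (rule weighted_snorm_least)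
      fix m
      show "norm ((x - l) m) * exp (real (Suc p) * \<epsilon> m) \<le> exp (- (real q - real p) * \<epsilon> n)"
      proof (cases "m < n")
        case True
        then show ?thesis by (simp add: lm)
      next
        case False
        have e: "exp (real (Suc p) * \<epsilon> m) = exp (real (Suc q) * \<epsilon> m) * exp (- (real q - real p) * \<epsilon> m)"
          by (simp add: exp_add[symmetric] algebra_simps)
        have "norm ((x - l) m) * exp (real (Suc p) * \<epsilon> m) =
            (norm (x m) * exp (real (Suc q) * \<epsilon> m)) * exp (- (real q - real p) * \<epsilon> m)"
          using False e by (simp add: lm)
        also have "\<dots> \<le> exp (- (real q - real p) * \<epsilon> m)"
          using xm[of m] by (intro mult_left_le_one_le) auto
        also have "\<dots> \<le> exp (- (real q - real p) * \<epsilon> n)"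
          using mult_left_mono[OF exponent_mono[OF exponent, of n m], of "real q - real p"] False assms
          by (simp add: left_diff_distrib)
        finally show ?thesis .
      qed
    qed
  qed
  moreover have "finite F" "card F \<le> n"
    unfolding F_def using card_image_le[of "{..<n}" "unit_seq :: nat \<Rightarrow> nat \<Rightarrow> 'k"] by auto
  ultimately show ?thesis
    unfolding E_def[symmetric] approximable_unit_ball_iff[OF unit_ball_subset_carr] using FE
    by (intro conjI exI[of _ F]) auto
qed

lemma Lambda_inf_diameter:
  assumes "p \<le> q"
  shows "kolmogorov_diameter (Lambda_inf \<epsilon> :: ('k::real_normed_field, nat \<Rightarrow> 'k) graded_space) n
    (unit_ball (Lambda_inf \<epsilon>) q) (unit_ball (Lambda_inf \<epsilon>) p) = exp (- (real q - real p) * \<epsilon> n)"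
proof -
  define E where "E = (Lambda_inf \<epsilon> :: ('k, nat \<Rightarrow> 'k) graded_space)"
  interpret seminormed_scale E
    unfolding E_def by (rule Lambda_inf_seminormed_scale[OF exponent])
  have "diam n q p \<le> exp (- (real q - real p) * \<epsilon> n)"
    unfolding E_def by (intro kolmogorov_diameter_le[unfolded E_def] absorbed_unit_balls[unfolded E_def]
        Lambda_inf_approximable assms)
  moreover have "exp (- (real q - real p) * \<epsilon> n) \<le> diam n q p"
    unfolding E_def
  proof (rule kolmogorov_diameter_greatest[unfolded E_def, OF absorbed_unit_balls[unfolded E_def, OF assms]])
    fix t assume "approximable (Lambda_inf \<epsilon> :: ('k, nat \<Rightarrow> 'k) graded_space) n
      (unit_ball (Lambda_inf \<epsilon>) q) (unit_ball (Lambda_inf \<epsilon>) p) t"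
    then show "exp (- (real q - real p) * \<epsilon> n) \<le> t"
      using Lambda_inf_box(1,3)[OF assms, where 'k = 'k] approximable_subset by blast
  qed
  ultimately show ?thesis unfolding E_def by simp
qed

lemma Lambda_inf_diameters_witnessed:
  "diameters_witnessed (Lambda_inf \<epsilon> :: ('k::real_normed_field, nat \<Rightarrow> 'k) graded_space)"
  unfolding diameters_witnessed_def
proof
  fix q
  have wit: "\<exists>Y\<subseteq>unit_ball (Lambda_inf \<epsilon> :: ('k, nat \<Rightarrow> 'k) graded_space) q.
      (\<forall>k. bdd_above (snorm (Lambda_inf \<epsilon>) k ` Y)) \<and>
      (\<forall>t. approximable (Lambda_inf \<epsilon>) n Y (unit_ball (Lambda_inf \<epsilon>) p) t \<longrightarrow>
        kolmogorov_diameter (Lambda_inf \<epsilon>) n (unit_ball (Lambda_inf \<epsilon>) q) (unit_ball (Lambda_inf \<epsilon>) p) \<le> 1 * t)"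
    if p: "p \<le> q" for p n
    unfolding Lambda_inf_diameter[OF p] mult_1
    using Lambda_inf_box[OF p, where 'k = 'k and n = n]
    by (intro exI conjI allI impI)
  show "\<exists>q'\<ge>q. \<exists>C>0. \<forall>p\<le>q. \<forall>n. \<exists>Y\<subseteq>unit_ball (Lambda_inf \<epsilon> :: ('k, nat \<Rightarrow> 'k) graded_space) q.
      (\<forall>k. bdd_above (snorm (Lambda_inf \<epsilon>) k ` Y)) \<and>
      (\<forall>t. approximable (Lambda_inf \<epsilon>) n Y (unit_ball (Lambda_inf \<epsilon>) p) t \<longrightarrow>
        kolmogorov_diameter (Lambda_inf \<epsilon>) n (unit_ball (Lambda_inf \<epsilon>) q') (unit_ball (Lambda_inf \<epsilon>) p) \<le> C * t)"
    by (intro exI[of _ q] exI[of _ "1::real"] conjI allI impI order_refl wit) simp_all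
qed

lemma eventually_exp_scaled_le:
  assumes "0 < \<eta>"
  shows "eventually (\<lambda>n. exp (- (r + 1) * \<epsilon> n) \<le> \<eta> * exp (- r * \<epsilon> n)) sequentially"
  using eventually_exp_uminus_le[OF exponent assms]
proof eventually_elim
  case (elim n)
  have "exp (- (r + 1) * \<epsilon> n) = exp (- \<epsilon> n) * exp (- r * \<epsilon> n)"
    by (simp add: exp_add[symmetric] algebra_simps)
  also have "\<dots> \<le> \<eta> * exp (- r * \<epsilon> n)" using elim by (intro mult_right_mono) auto
  finally show ?case .
qed

lemma tendsto_exp_uminus: "(\<lambda>n. C * exp (- \<epsilon> n)) \<longlonglongrightarrow> 0"
proof -
  have "filterlim \<epsilon> at_top sequentially" using exponent by (simp add: exponent_sequence_def)
  then have "(\<lambda>n. exp (- \<epsilon> n)) \<longlonglongrightarrow> 0"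
    by (intro filterlim_compose[OF exp_at_bot] filterlim_compose[OF filterlim_uminus_at_bot_at_top])
  then show ?thesis by (rule tendsto_mult_right_zero)
qed

lemma diametral_dimension_Lambda_inf_iff:
  fixes t :: "nat \<Rightarrow> 'k::real_normed_field"
  shows "t \<in> diametral_dimension (Lambda_inf \<epsilon>) \<longleftrightarrow>
    (\<exists>R::nat. eventually (\<lambda>n. norm (t n) \<le> exp (real R * \<epsilon> n)) sequentially)"
proof
  assume "t \<in> diametral_dimension (Lambda_inf \<epsilon>)"
  then obtain q where q: "q > 0" "(\<lambda>n. t n * of_real (kolmogorov_diameter (Lambda_inf \<epsilon> :: ('k, nat \<Rightarrow> 'k) graded_space) n
      (unit_ball (Lambda_inf \<epsilon>) q) (unit_ball (Lambda_inf \<epsilon>) 0))) \<longlonglongrightarrow> 0"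
    unfolding diametral_dimension_def by blast
  then have "(\<lambda>n. t n * of_real (exp (- (real q - real 0) * \<epsilon> n))) \<longlonglongrightarrow> 0"
    by (simp add: Lambda_inf_diameter)
  then have "eventually (\<lambda>n. norm (t n * of_real (exp (- (real q - real 0) * \<epsilon> n))) < 1) sequentially"
    using order_tendstoD(2)[OF tendsto_norm_zero] by force
  then have "eventually (\<lambda>n. norm (t n) \<le> exp (real q * \<epsilon> n)) sequentially"
    by eventually_elim (simp add: norm_mult norm_divide exp_minus field_simps)
  then show "\<exists>R::nat. eventually (\<lambda>n. norm (t n) \<le> exp (real R * \<epsilon> n)) sequentially" by blast
next
  assume "\<exists>R::nat. eventually (\<lambda>n. norm (t n) \<le> exp (real R * \<epsilon> n)) sequentially"
  then obtain R :: nat where R: "eventually (\<lambda>n. norm (t n) \<le> exp (real R * \<epsilon> n)) sequentially" by blast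
  show "t \<in> diametral_dimension (Lambda_inf \<epsilon>)"
    unfolding diametral_dimension_def
  proof (intro CollectI allI exI conjI)
    fix p show "p < p + R + 1" by simp
    have "eventually (\<lambda>n. norm (t n * of_real (kolmogorov_diameter (Lambda_inf \<epsilon> :: ('k, nat \<Rightarrow> 'k) graded_space) n
      (unit_ball (Lambda_inf \<epsilon>) (p + R + 1)) (unit_ball (Lambda_inf \<epsilon>) p))) \<le> 1 * exp (- \<epsilon> n)) sequentially"
      using R
    proof eventually_elim
      case (elim n)
      have "norm (t n) * exp (- (real (p + R + 1) - real p) * \<epsilon> n) \<le>
          exp (real R * \<epsilon> n) * exp (- (real (p + R + 1) - real p) * \<epsilon> n)"
        using elim by (intro mult_right_mono) auto
      also have "\<dots> = exp (- \<epsilon> n)"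
        by (simp add: exp_add[symmetric] algebra_simps)
      finally show ?case
        by (simp add: Lambda_inf_diameter norm_mult)
    qed
    then show "(\<lambda>n. t n * of_real (kolmogorov_diameter (Lambda_inf \<epsilon> :: ('k, nat \<Rightarrow> 'k) graded_space) n
      (unit_ball (Lambda_inf \<epsilon>) (p + R + 1)) (unit_ball (Lambda_inf \<epsilon>) p))) \<longlonglongrightarrow> 0"
      by (rule Lim_null_comparison[OF _ tendsto_exp_uminus])
  qed
qed

lemma approx_diametral_dimension_Lambda_inf_iff:
  fixes t :: "nat \<Rightarrow> 'k::real_normed_field"
  shows "t \<in> approx_diametral_dimension (Lambda_inf \<epsilon>) \<longleftrightarrow>
    (\<forall>R::nat. eventually (\<lambda>n. norm (t n) \<le> exp (- real R * \<epsilon> n)) sequentially)"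
proof
  define E where "E = (Lambda_inf \<epsilon> :: ('k, nat \<Rightarrow> 'k) graded_space)"
  interpret seminormed_scale E
    unfolding E_def by (rule Lambda_inf_seminormed_scale[OF exponent])
  have diam: "diam n q p = exp (- (real q - real p) * \<epsilon> n)" if "p \<le> q" for n q p
    unfolding E_def using that by (rule Lambda_inf_diameter)
  {
    assume "t \<in> approx_diametral_dimension (Lambda_inf \<epsilon>)"
    then obtain p where p: "\<And>q \<eta>. q \<ge> p \<Longrightarrow> 0 < \<eta> \<Longrightarrow> eventually (\<lambda>n. norm (t n) \<le> \<eta> * diam n q p) sequentially"
      using approx_diametral_dimensionD[of t] unfolding E_def by blast
    show "\<forall>R::nat. eventually (\<lambda>n. norm (t n) \<le> exp (- real R * \<epsilon> n)) sequentially"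
    proof
      fix R :: nat
      show "eventually (\<lambda>n. norm (t n) \<le> exp (- real R * \<epsilon> n)) sequentially"
        using p[of "p + R" 1] by (simp add: diam)
    qed
  next
    assume R: "\<forall>R::nat. eventually (\<lambda>n. norm (t n) \<le> exp (- real R * \<epsilon> n)) sequentially"
    have "t \<in> approx_diametral_dimension E"
    proof (rule approx_diametral_dimensionI)
      show "diameters_witnessed E" unfolding E_def by (rule Lambda_inf_diameters_witnessed)
      fix q :: nat and \<eta> :: real assume "0 < \<eta>"
      show "eventually (\<lambda>n. norm (t n) \<le> \<eta> * diam n q 0) sequentially"
        using R[rule_format, of "Suc q"] eventually_exp_scaled_le[OF \<open>0 < \<eta>\<close>, of "real q"]
        by eventually_elim (simp add: diam add.commute)
    qed
    then show "t \<in> approx_diametral_dimension (Lambda_inf \<epsilon>)" by (simp add: E_def)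
  }
qed

end

section \<open>Comparison of the two dimensions\<close>

context seminormed_scale
begin

lemma approx_diametral_dimension_decay:
  assumes exps: "\<And>R::nat. (\<lambda>n. of_real (exp (real R * \<epsilon> n))) \<in> diametral_dimension E"
    and t: "t \<in> approx_diametral_dimension E"
  shows "eventually (\<lambda>n. norm (t n) \<le> exp (- real R * \<epsilon> n)) sequentially"
proof -
  obtain p where p: "\<And>q \<eta>. q \<ge> p \<Longrightarrow> 0 < \<eta> \<Longrightarrow> eventually (\<lambda>n. norm (t n) \<le> \<eta> * diam n q p) sequentially"
    using approx_diametral_dimensionD[OF t] by blast
  obtain q where q: "q > p" "(\<lambda>n. of_real (exp (real R * \<epsilon> n)) * of_real (diam n q p) :: 'k) \<longlonglongrightarrow> 0"
    using exps[of R] unfolding diametral_dimension_def by blast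
  have "eventually (\<lambda>n. norm (of_real (exp (real R * \<epsilon> n)) * of_real (diam n q p) :: 'k) < 1) sequentially"
    using order_tendstoD(2)[OF tendsto_norm_zero[OF q(2)]] by force
  moreover have "eventually (\<lambda>n. norm (t n) \<le> 1 * diam n q p) sequentially"
    using p[of q 1] q(1) by simp
  ultimately show ?thesis
  proof eventually_elim
    case (elim n)
    have "exp (real R * \<epsilon> n) * diam n q p \<le> 1"
      using elim(1) by (simp add: norm_mult flip: of_real_mult)
    then have "diam n q p \<le> exp (- real R * \<epsilon> n)"
      by (simp add: exp_minus field_simps)
    then show ?case using elim(2) by simp
  qed
qed

text \<open>
  If \<open>t\<close> were missing, for some \<open>p\<close> and every \<open>q\<close> the diameters would be at least
  \<open>exp (- (R + 1) \<epsilon>\<^sub>n)\<close> infinitely often. As they decrease in \<open>q\<close>, one sequence of indices \<open>r j\<close> serves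
  all \<open>q\<close>, and \<open>exp (- (R + 2) \<epsilon>\<^sub>n)\<close> restricted to these indices is negligible against all
  diameters although its decay is only of exponential order.
\<close>

lemma diametral_dimension_contains_exponential_growth:
  assumes \<epsilon>: "exponent_sequence \<epsilon>" and wit: "diameters_witnessed E"
    and decay: "\<And>u R. u \<in> approx_diametral_dimension E \<Longrightarrow>
      eventually (\<lambda>n. norm (u n) \<le> exp (- real (R::nat) * \<epsilon> n)) sequentially"
    and t: "eventually (\<lambda>n. norm (t n) \<le> exp (real (R::nat) * \<epsilon> n)) sequentially"
  shows "t \<in> diametral_dimension E"
proof (rule ccontr)
  assume "t \<notin> diametral_dimension E"
  then obtain p where p: "\<And>q. q > p \<Longrightarrow> \<not> (\<lambda>n. t n * of_real (diam n q p)) \<longlonglongrightarrow> 0"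
    unfolding diametral_dimension_def by blast
  have dnn: "0 \<le> diam n q p" if "q \<ge> p" for n q
    using that by (intro kolmogorov_diameter_nonneg absorbed_unit_balls)
  have "frequently (\<lambda>n. exp (- (real R + 1) * \<epsilon> n) \<le> diam n (p + Suc q) p) sequentially" for q
  proof (rule ccontr)
    assume "\<not> ?thesis"
    then have "eventually (\<lambda>n. \<not> exp (- (real R + 1) * \<epsilon> n) \<le> diam n (p + Suc q) p) sequentially"
      by (simp add: not_frequently)
    with t have "eventually (\<lambda>n. norm (t n * of_real (diam n (p + Suc q) p)) \<le> 1 * exp (- \<epsilon> n)) sequentially"
    proof eventually_elim
      case (elim n)
      have "norm (t n) * diam n (p + Suc q) p \<le> exp (real R * \<epsilon> n) * exp (- (real R + 1) * \<epsilon> n)"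
        using elim dnn[of "p + Suc q" n] by (intro mult_mono) auto
      also have "\<dots> = exp (- \<epsilon> n)"
        by (simp add: exp_add[symmetric] algebra_simps)
      finally show ?case using dnn[of "p + Suc q" n] by (simp add: norm_mult)
    qed
    then have "(\<lambda>n. t n * of_real (diam n (p + Suc q) p)) \<longlonglongrightarrow> 0"
      by (rule Lim_null_comparison[OF _ tendsto_exp_uminus[OF \<epsilon>]])
    then show False using p[of "p + Suc q"] by simp
  qed
  then obtain r where r: "strict_mono r" "\<And>j. exp (- (real R + 1) * \<epsilon> (r j)) \<le> diam (r j) (p + Suc j) p"
    using frequently_diagonal[of "\<lambda>q n. exp (- (real R + 1) * \<epsilon> n) \<le> diam n (p + Suc q) p"] by blast
  define u :: "nat \<Rightarrow> 'k" where "u n = (if n \<in> range r then of_real (exp (- (real R + 1 + 1) * \<epsilon> n)) else 0)" for n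
  have "u \<in> approx_diametral_dimension E"
  proof (rule approx_diametral_dimensionI[OF wit])
    fix q and \<eta> :: real assume q: "q \<ge> p" and \<eta>: "0 < \<eta>"
    have "eventually (\<lambda>n. r q \<le> n) sequentially" by (rule eventually_ge_at_top)
    with eventually_exp_scaled_le[OF \<epsilon> \<eta>, of "real R + 1"]
    show "eventually (\<lambda>n. norm (u n) \<le> \<eta> * diam n q p) sequentially"
    proof eventually_elim
      case (elim n)
      show ?case
      proof (cases "n \<in> range r")
        case True
        then obtain j where j: "n = r j" by blast
        then have "q \<le> j" using elim(2) r(1) by (simp add: strict_mono_less_eq)
        have "norm (u n) \<le> \<eta> * exp (- (real R + 1) * \<epsilon> n)"
          using elim(1) True by (simp add: u_def)
        also have "\<dots> \<le> \<eta> * diam n (p + Suc j) p"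
          using r(2)[of j] \<eta> j by (intro mult_left_mono) auto
        also have "\<dots> \<le> \<eta> * diam n q p"
          using \<eta> \<open>q \<le> j\<close> q by (intro mult_left_mono diam_antimono) auto
        finally show ?thesis .
      next
        case False
        then show ?thesis using dnn[OF q, of n] \<eta> by (simp add: u_def)
      qed
    qed
  qed
  then have "eventually (\<lambda>n. norm (u n) \<le> exp (- real (R + 3) * \<epsilon> n)) sequentially"
    by (rule decay)
  moreover have "eventually (\<lambda>n. 1 \<le> \<epsilon> n) sequentially"
    using \<epsilon> unfolding exponent_sequence_def filterlim_at_top by blast
  ultimately have "eventually (\<lambda>n. n \<notin> range r) sequentially"
  proof eventually_elim
    case (elim n)
    show ?case
    proof
      assume "n \<in> range r"
      then have "- (real R + 1 + 1) * \<epsilon> n \<le> - real (R + 3) * \<epsilon> n"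
        using elim(1) by (simp add: u_def)
      then have "\<epsilon> n \<le> 0" by (simp add: algebra_simps)
      then show False using elim(2) by simp
    qed
  qed
  then obtain N where "\<And>n. n \<ge> N \<Longrightarrow> n \<notin> range r"
    unfolding eventually_sequentially by blast
  then show False using seq_suble[OF r(1), of N] by blast
qed

text \<open>
  Suppose \<open>d\<^sub>n(U\<^sub>k, U\<^sub>p) < exp (- j \<epsilon>\<^sub>n)\<close> at indices \<open>n = r j\<close>. By \<open>DN_diameters\<close> each \<open>k\<^sub>0\<close> admits \<open>m\<close> and
  \<open>s > 0\<close> with \<open>d\<^sub>n(U\<^sub>m, U\<^sub>k\<^sub>0)\<close> at most a multiple of \<open>exp ((1 + s - s j) \<epsilon>\<^sub>n)\<close> there. The sequence with value
  \<open>exp (\<surd>j \<epsilon>\<^sub>n)\<close> at \<open>n = r j\<close> and 0 elsewhere then belongs to the diametral dimension, because \<open>\<surd>j\<close>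
  is dominated by \<open>s j\<close> for every \<open>s > 0\<close>; but \<open>\<surd>j\<close> is unbounded, so no
  \<open>exp (R \<epsilon>\<^sub>n)\<close> bounds the sequence.
\<close>

lemma DN_diameter_lower_bound:
  assumes \<epsilon>: "exponent_sequence \<epsilon>" and DN: "has_DN E" and nuc: "nuclear_space E"
    and growth: "\<And>n. real (Suc n) \<le> G * exp (\<epsilon> n)"
    and bound: "\<And>t. t \<in> diametral_dimension E \<Longrightarrow>
      \<exists>R::nat. eventually (\<lambda>n. norm (t n) \<le> exp (real R * \<epsilon> n)) sequentially"
  shows "\<exists>p. \<forall>k>p. \<exists>S::nat. eventually (\<lambda>n. exp (- real S * \<epsilon> n) \<le> diam n k p) sequentially"
proof -
  obtain p where p: "\<And>k. k > p \<Longrightarrow> \<exists>m\<ge>k. \<exists>C>0. \<exists>s>0. \<forall>n \<delta>. diam n k p < \<delta> \<longrightarrow>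
      diam n m k \<le> C * (2 * real n + 1) powr (1 + s) * \<delta> powr s"
    using DN_diameters[OF DN nuc] by blast
  have "\<exists>S::nat. eventually (\<lambda>n. exp (- real S * \<epsilon> n) \<le> diam n k p) sequentially" if k: "k > p" for k
  proof (rule ccontr)
    assume "\<not> ?thesis"
    then have "frequently (\<lambda>n. diam n k p < exp (- real S * \<epsilon> n)) sequentially" for S :: nat
      by (simp add: frequently_def not_less)
    then obtain r where r: "strict_mono r" "\<And>j. diam (r j) k p < exp (- real j * \<epsilon> (r j))"
      using frequently_diagonal[of "\<lambda>S n. diam n k p < exp (- real S * \<epsilon> n)"] by blast
    define t :: "nat \<Rightarrow> 'k" where
      "t n = (if n \<in> range r then of_real (exp (sqrt (real (inv_into UNIV r n)) * \<epsilon> n)) else 0)" for n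
    have tr: "norm (t (r j)) = exp (sqrt (real j) * \<epsilon> (r j))" for j
      using strict_mono_imp_inj_on[OF r(1)] by (simp add: t_def)
    have "t \<in> diametral_dimension E"
      unfolding diametral_dimension_def
    proof (intro CollectI allI)
      fix k0
      obtain m C s where m: "m \<ge> max k k0" "C > 0" "s > 0"
        "\<And>n \<delta>. diam n (max k k0) p < \<delta> \<Longrightarrow> diam n m (max k k0) \<le> C * (2 * real n + 1) powr (1 + s) * \<delta> powr s"
        using p[of "max k k0"] k by fastforce
      define D where "D = C * (2 * G) powr (1 + s)"
      have "filterlim (\<lambda>j. s * real j - sqrt (real j)) at_top sequentially"
        using m(3) by real_asymp
      then have "eventually (\<lambda>j. 2 + s \<le> s * real j - sqrt (real j)) sequentially"
        unfolding filterlim_at_top by blast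
      then obtain J where J: "\<And>j. j \<ge> J \<Longrightarrow> 2 + s \<le> s * real j - sqrt (real j)"
        unfolding eventually_sequentially by blast
      have "norm (t n * of_real (diam n (Suc m) k0)) \<le> D * exp (- \<epsilon> n)" if n: "n \<ge> r J" for n
      proof (cases "n \<in> range r")
        case True
        then obtain j where j: "n = r j" by blast
        then have "J \<le> j" using n r(1) by (simp add: strict_mono_less_eq)
        have d0: "0 \<le> diam n (Suc m) k0"
          using m(1) by (intro kolmogorov_diameter_nonneg absorbed_unit_balls) auto
        have "diam n (Suc m) k0 \<le> diam n m k0"
          using m(1) by (intro diam_antimono) auto
        also have "\<dots> \<le> diam n m (max k k0)"
          using m(1) by (intro diam_mono) auto
        also have "\<dots> \<le> C * (2 * real n + 1) powr (1 + s) * exp (- real j * \<epsilon> n) powr s"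
        proof (rule m(4))
          have "diam n (max k k0) p \<le> diam n k p" using k by (intro diam_antimono) auto
          then show "diam n (max k k0) p < exp (- real j * \<epsilon> n)" using r(2)[of j] j by simp
        qed
        also have "\<dots> \<le> C * (2 * G * exp (\<epsilon> n)) powr (1 + s) * exp (- real j * \<epsilon> n) powr s"
          using growth[of n] m(2,3) by (intro mult_right_mono mult_left_mono powr_mono2) auto
        also have "\<dots> = D * (exp ((1 + s) * \<epsilon> n) * exp (- (s * real j * \<epsilon> n)))"
          by (simp add: D_def powr_mult exp_powr_real mult_ac)
        also have "\<dots> = D * exp ((1 + s) * \<epsilon> n - s * real j * \<epsilon> n)"
          by (simp add: exp_add[symmetric])
        finally have "diam n (Suc m) k0 \<le> D * exp ((1 + s) * \<epsilon> n - s * real j * \<epsilon> n)" .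
        then have "norm (t n * of_real (diam n (Suc m) k0)) \<le>
            exp (sqrt (real j) * \<epsilon> n) * (D * exp ((1 + s) * \<epsilon> n - s * real j * \<epsilon> n))"
          using tr[of j] j d0 by (simp add: norm_mult)
        also have "\<dots> = D * exp (- (s * real j - sqrt (real j) - (1 + s)) * \<epsilon> n)"
          by (simp add: exp_add[symmetric] algebra_simps)
        also have "\<dots> \<le> D * exp (- 1 * \<epsilon> n)"
          using J[OF \<open>J \<le> j\<close>] exponent_nonneg[OF \<epsilon>, of n] m(2)
          by (intro mult_left_mono exp_le_cancel_iff[THEN iffD2] mult_right_mono) (auto simp: D_def)
        finally show ?thesis by simp
      next
        case False
        then show ?thesis using m(2) by (simp add: t_def D_def)
      qed
      then have "(\<lambda>n. t n * of_real (diam n (Suc m) k0)) \<longlonglongrightarrow> 0"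
        by (intro Lim_null_comparison[OF _ tendsto_exp_uminus[OF \<epsilon>]])
          (auto simp: eventually_sequentially)
      then show "\<exists>q>k0. (\<lambda>n. t n * of_real (diam n q k0)) \<longlonglongrightarrow> 0"
        using m(1) by (intro exI[of _ "Suc m"]) auto
    qed
    then obtain R :: nat where "eventually (\<lambda>n. norm (t n) \<le> exp (real R * \<epsilon> n)) sequentially"
      using bound by blast
    moreover have "eventually (\<lambda>n. 1 \<le> \<epsilon> n) sequentially"
      using \<epsilon> unfolding exponent_sequence_def filterlim_at_top by blast
    ultimately have "eventually (\<lambda>n. norm (t n) \<le> exp (real R * \<epsilon> n) \<and> 1 \<le> \<epsilon> n) sequentially"
      by (rule eventually_conj)
    then obtain N where N: "\<And>n. n \<ge> N \<Longrightarrow> norm (t n) \<le> exp (real R * \<epsilon> n) \<and> 1 \<le> \<epsilon> n"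
      unfolding eventually_sequentially by blast
    \<comment> \<open>The index is chosen with \<open>\<surd>j > R\<close>.\<close>
    define j where "j = max N (Suc (R ^ 2))"
    have "r j \<ge> N" using seq_suble[OF r(1), of j] by (simp add: j_def)
    then have "exp (sqrt (real j) * \<epsilon> (r j)) \<le> exp (real R * \<epsilon> (r j))" "1 \<le> \<epsilon> (r j)"
      using N tr by force+
    then have "sqrt (real j) \<le> real R" by simp
    then have "real j \<le> (real R)\<^sup>2" by (rule sqrt_le_D)
    moreover have "(real R)\<^sup>2 < real j"
      by (simp add: j_def less_max_iff_disj flip: of_nat_power)
    ultimately show False by simp
  qed
  then show ?thesis by blast
qed

lemma exponential_decay_in_approx_diametral_dimension:
  assumes \<epsilon>: "exponent_sequence \<epsilon>" and DN: "has_DN E" and nuc: "nuclear_space E"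
    and growth: "\<And>n. real (Suc n) \<le> G * exp (\<epsilon> n)"
    and bound: "\<And>t. t \<in> diametral_dimension E \<Longrightarrow>
      \<exists>R::nat. eventually (\<lambda>n. norm (t n) \<le> exp (real R * \<epsilon> n)) sequentially"
    and t: "\<And>R::nat. eventually (\<lambda>n. norm (t n) \<le> exp (- real R * \<epsilon> n)) sequentially"
  shows "t \<in> approx_diametral_dimension E"
proof -
  obtain p where p: "\<And>k. k > p \<Longrightarrow> \<exists>S::nat. eventually (\<lambda>n. exp (- real S * \<epsilon> n) \<le> diam n k p) sequentially"
    using DN_diameter_lower_bound[OF \<epsilon> DN nuc growth bound] by blast
  show ?thesis
  proof (rule approx_diametral_dimensionI[OF nuclear_diameters_witnessed[OF nuc]])
    fix q and \<eta> :: real assume q: "q \<ge> p" and \<eta>: "0 < \<eta>"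
    obtain S :: nat where "eventually (\<lambda>n. exp (- real S * \<epsilon> n) \<le> diam n (Suc q) p) sequentially"
      using p[of "Suc q"] q by auto
    with t[of "S + 1"] eventually_exp_scaled_le[OF \<epsilon> \<eta>, of "real S"]
    show "eventually (\<lambda>n. norm (t n) \<le> \<eta> * diam n q p) sequentially"
    proof eventually_elim
      case (elim n)
      have "norm (t n) \<le> \<eta> * exp (- real S * \<epsilon> n)"
        using elim(1,2) by (simp add: add.commute)
      also have "\<dots> \<le> \<eta> * diam n (Suc q) p" using elim(3) \<eta> by simp
      also have "\<dots> \<le> \<eta> * diam n q p"
        using \<eta> q by (intro mult_left_mono diam_antimono) auto
      finally show ?case .
    qed
  qed
qed

end

lemma nuclear_frechet_seminormed_scale:
  "nuclear_frechet_space E \<Longrightarrow> seminormed_scale E"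
  by (auto simp: nuclear_frechet_space_def seminormed_scale_def seminormed_scale_axioms_def)

theorem theorem3p1:
  fixes E :: "('k::real_normed_field, 'a::ab_group_add) graded_space"
    and \<epsilon> :: "nat \<Rightarrow> real"
  assumes "nuclear_frechet_space E"
    and "has_DN E"
    and "has_Omega E"
    and "nuclear_space (Lambda_1 \<epsilon> :: ('k, nat \<Rightarrow> 'k) graded_space)"
    and "associated_exponent_sequence E \<epsilon>"
  shows "diametral_dimension E = diametral_dimension (Lambda_inf \<epsilon>) \<longleftrightarrow>
    approx_diametral_dimension E = approx_diametral_dimension (Lambda_inf \<epsilon>)"
proof -
  interpret seminormed_scale E
    using assms(1) by (rule nuclear_frechet_seminormed_scale)
  have \<epsilon>: "exponent_sequence \<epsilon>"
    and sub: "diametral_dimension E \<subseteq> diametral_dimension (Lambda_inf \<epsilon>)"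
    using assms(5) by (auto simp: associated_exponent_sequence_def)
  have nuc: "nuclear_space E"
    using assms(1) by (simp add: nuclear_frechet_space_def)
  obtain G where growth: "\<And>n. real (Suc n) \<le> G * exp (\<epsilon> n)"
    using nuclear_Lambda_1_growth[OF \<epsilon> assms(4)] by blast
  note Delta_iff = diametral_dimension_Lambda_inf_iff[OF \<epsilon>]
  note delta_iff = approx_diametral_dimension_Lambda_inf_iff[OF \<epsilon>]
  have bound: "\<exists>R::nat. eventually (\<lambda>n. norm (t n) \<le> exp (real R * \<epsilon> n)) sequentially"
    if "t \<in> diametral_dimension E" for t
    using that sub Delta_iff by blast
  show ?thesis
  proof
    assume eq: "diametral_dimension E = diametral_dimension (Lambda_inf \<epsilon>)"
    have "(\<lambda>n. of_real (exp (real R * \<epsilon> n))) \<in> diametral_dimension E" for R :: nat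
      unfolding eq Delta_iff by (intro exI[of _ R]) simp
    then show "approx_diametral_dimension E = approx_diametral_dimension (Lambda_inf \<epsilon>)"
      using approx_diametral_dimension_decay[where \<epsilon> = \<epsilon>]
        exponential_decay_in_approx_diametral_dimension[OF \<epsilon> assms(2) nuc growth bound]
      by (auto simp: delta_iff)
  next
    assume "approx_diametral_dimension E = approx_diametral_dimension (Lambda_inf \<epsilon>)"
    then have "eventually (\<lambda>n. norm (u n) \<le> exp (- real R * \<epsilon> n)) sequentially"
      if "u \<in> approx_diametral_dimension E" for u and R :: nat
      using that delta_iff by blast
    then have "diametral_dimension (Lambda_inf \<epsilon>) \<subseteq> diametral_dimension E"
      using diametral_dimension_contains_exponential_growth[OF \<epsilon> nuclear_diameters_witnessed[OF nuc]]
      by (auto simp: Delta_iff)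
    then show "diametral_dimension E = diametral_dimension (Lambda_inf \<epsilon>)"
      using sub by blast
  qed
qed

end
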